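(* Let $E$ be an arbitrary subset of $\mathbb{R}^n$, $X\subset\mathbb{R}^n$ a linear subspace, $P_X:\mathbb{R}^n\to X$ the orthogonal projection, and $f:E\to\mathbb{R}$, $G:E\to\mathbb{R}^n$ two functions. There exists a Lipschitz convex function $F:\mathbb{R}^n\to\mathbb{R}$ of class $C^1$ such that $F(x)=f(x)$ and $\nabla F(x)=G(x)$ for all $x\in E$, and $X_F=X$, if and only if the following conditions are satisfied. (i) $G$ is continuous and bounded and $f(x)\geq f(y)+\langle G(y),x-y\rangle$ for all $x,y\in E$. (ii) $Y:=\mathrm{span}\left(\{G(x)-G(y) : x,y\in E\}\right)\subseteq X$. (iii) If $Y\neq X$ and we denote $k=\dim Y$ and $d=\dim X$, there exist points $p_1,\ldots,p_{d-k}\in\mathbb{R}^n\setminus\overline{E}$, a number $\varepsilon\in(0,1)$, and linearly independent normalized vectors $w_1,\ldots,w_{d-k}\in X\cap Y^{\perp}$ (that is, $|w_j|=1$ for each $j$) such that, for every $j=1,\ldots,d-k$, the cone $$V_j:=\{x\in\mathbb{R}^n : \varepsilon\langle w_j,x-p_j\rangle\geq|P_Y(x-p_j)|\}$$ does not contain any point of $\overline{E}$, where $P_Y:\mathbb{R}^n\to Y$ denotes the orthogonal projection onto $Y$. (iv) If $(x_k)_k,(z_k)_k$ are sequences in $E$ such that $(P_X(x_k))_k$ is bounded and $$\lim_{k\to\infty}\left(f(x_k)-f(z_k)-\langle G(z_k),x_k-z_k\rangle\right)=0,$$ then $\lim_{k\to\infty}|G(x_k)-G(z_k)|=0$. Moreover,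 there exists a constant $C(n)>0$ only depending on $n$ such that, whenever these conditions are satisfied, the extension $F$ can be taken so that $$\mathrm{Lip}(F)=\sup_{x\in\mathbb{R}^n}|\nabla F(x)|\leq C(n)\sup_{y\in E}|G(y)|.$$
   Context: $\langle\cdot,\cdot\rangle$ and $|\cdot|$ denote the Euclidean inner product and norm on $\mathbb{R}^n$, $\overline{E}$ is the closure of $E$, and $\mathrm{Lip}(F)$ is the best Lipschitz constant of $F$. For a linear subspace $X$ of $\mathbb{R}^n$, $P_X$ denotes the orthogonal projection onto $X$ and $X^{\perp}$ the orthogonal complement. A function $c:X\to\mathbb{R}$ is essentially coercive if there is a linear function $\ell:X\to\mathbb{R}$ such that $\lim_{k\to\infty}(c-\ell)(x_k)=\infty$ for every sequence $(x_k)_k\subset X$ with $|x_k|\to\infty$ (so every function on $\{0\}$ is essentially coercive). For a convex function $F:\mathbb{R}^n\to\mathbb{R}$, $X_F$ denotes the unique linear subspace of $\mathbb{R}^n$ for which there exist a vector $v_F\in X_F^{\perp}$ and an essentially coercive function $c_F:X_F\to\mathbb{R}$ such that $F(x)=c_F(P_{X_F}(x))+\langle v_F,x\rangle$ for all $x\in\mathbb{R}^n$ (it is a theorem that such $X_F,v_F,c_F$ exist and are unique).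
   Formalization: The final bound on Lip(F) is stated only when G is nonzero somewhere on E or X={0}; if G vanishes on E (or E is empty) and X≠{0}, the printed bound would force F constant, hence X_F={0}≠X. The equivalence is unrestricted. *)

theory Defs
  imports "HOL-Analysis.Analysis"
begin

definition grad :: "('a::euclidean_space \<Rightarrow> real) \<Rightarrow> 'a \<Rightarrow> 'a" where
  "grad F x = (THE D. GDERIV F x :> D)"

definition C1_function :: "('a::euclidean_space \<Rightarrow> real) \<Rightarrow> bool" where
  "C1_function F \<longleftrightarrow> (\<forall>x. F differentiable (at x)) \<and> continuous_on UNIV (grad F)"

text \<open>The best Lipschitz constant; meaningful when \<open>F\<close> is Lipschitz.\<close>

definition Lip :: "('a::euclidean_space \<Rightarrow> real) \<Rightarrow> real" where
  "Lip F = Inf {L. L-lipschitz_on UNIV F}"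

text \<open>Orthogonal projection onto a linear subspace \<open>X\<close>.\<close>

definition orth_proj :: "'a::euclidean_space set \<Rightarrow> 'a \<Rightarrow> 'a" where
  "orth_proj X x = (THE y. y \<in> X \<and> x - y \<in> X\<^sup>\<bottom>)"

text \<open>Functions on a subspace \<open>X\<close> are total functions whose values off \<open>X\<close> are never used.
  The linear function \<open>l\<close> may be taken linear on the whole space, since every linear function on
  \<open>X\<close> extends.\<close>

definition essentially_coercive_on :: "'a::euclidean_space set \<Rightarrow> ('a \<Rightarrow> real) \<Rightarrow> bool" where
  "essentially_coercive_on X c \<longleftrightarrow>
     (\<exists>l::'a \<Rightarrow> real. linear l \<and>
        (\<forall>x::nat \<Rightarrow> 'a. (\<forall>k. x k \<in> X) \<longrightarrow>
           filterlim (\<lambda>k. norm (x k)) at_top sequentially \<longrightarrow>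
           filterlim (\<lambda>k. c (x k) - l (x k)) at_top sequentially))"

text \<open>The subspace \<open>X\<^sub>F\<close>. For convex \<open>F\<close> exactly one subspace \<open>X\<close> satisfies the description.\<close>

definition coercivity_subspace :: "('a::euclidean_space \<Rightarrow> real) \<Rightarrow> 'a set" where
  "coercivity_subspace F =
     (THE X. subspace X \<and>
        (\<exists>v c. v \<in> X\<^sup>\<bottom> \<and> essentially_coercive_on X c \<and>
           (\<forall>x. F x = c (orth_proj X x) + v \<bullet> x)))"

definition convex_C1_extension ::
    "'a::euclidean_space set \<Rightarrow> 'a set \<Rightarrow> ('a \<Rightarrow> real) \<Rightarrow> ('a \<Rightarrow> 'a) \<Rightarrow> ('a \<Rightarrow> real) \<Rightarrow> bool" where
  "convex_C1_extension E X f G F \<longleftrightarrow>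
     (\<exists>L. L-lipschitz_on UNIV F) \<and> convex_on UNIV F \<and> C1_function F \<and>
     (\<forall>x\<in>E. F x = f x \<and> grad F x = G x) \<and>
     coercivity_subspace F = X"

definition gradient_span :: "'a::euclidean_space set \<Rightarrow> ('a \<Rightarrow> 'a) \<Rightarrow> 'a set" where
  "gradient_span E G = span {G x - G y | x y. x \<in> E \<and> y \<in> E}"

definition cone_at :: "'a::euclidean_space set \<Rightarrow> real \<Rightarrow> 'a \<Rightarrow> 'a \<Rightarrow> 'a set" where
  "cone_at Y \<epsilon> w p = {x. \<epsilon> * (w \<bullet> (x - p)) \<ge> norm (orth_proj Y (x - p))}"

definition condition_i :: "'a::euclidean_space set \<Rightarrow> ('a \<Rightarrow> real) \<Rightarrow> ('a \<Rightarrow> 'a) \<Rightarrow> bool" where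
  "condition_i E f G \<longleftrightarrow>
     continuous_on E G \<and> bounded (G ` E) \<and>
     (\<forall>x\<in>E. \<forall>y\<in>E. f x \<ge> f y + G y \<bullet> (x - y))"

definition condition_ii :: "'a::euclidean_space set \<Rightarrow> 'a set \<Rightarrow> ('a \<Rightarrow> 'a) \<Rightarrow> bool" where
  "condition_ii E X G \<longleftrightarrow> gradient_span E G \<subseteq> X"

text \<open>The truncated difference \<open>dim X - dim Y\<close> is the true one as soon as \<open>Y \<subseteq> X\<close>. Injectivity of
  \<open>w\<close> makes \<open>independent\<close> of its range express linear independence of the family.\<close>

definition condition_iii :: "'a::euclidean_space set \<Rightarrow> 'a set \<Rightarrow> ('a \<Rightarrow> 'a) \<Rightarrow> bool" where
  "condition_iii E X G \<longleftrightarrow>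
     (let Y = gradient_span E G; J = {1..dim X - dim Y} in
      Y \<noteq> X \<longrightarrow>
      (\<exists>(p::nat \<Rightarrow> 'a) (\<epsilon>::real) (w::nat \<Rightarrow> 'a).
         (\<forall>j\<in>J. p j \<notin> closure E) \<and>
         0 < \<epsilon> \<and> \<epsilon> < 1 \<and>
         inj_on w J \<and> independent (w ` J) \<and>
         (\<forall>j\<in>J. w j \<in> X \<inter> Y\<^sup>\<bottom> \<and> norm (w j) = 1) \<and>
         (\<forall>j\<in>J. cone_at Y \<epsilon> (w j) (p j) \<inter> closure E = {})))"

definition condition_iv ::
    "'a::euclidean_space set \<Rightarrow> 'a set \<Rightarrow> ('a \<Rightarrow> real) \<Rightarrow> ('a \<Rightarrow> 'a) \<Rightarrow> bool" where
  "condition_iv E X f G \<longleftrightarrow>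
     (\<forall>x z::nat \<Rightarrow> 'a.
        (\<forall>k. x k \<in> E) \<longrightarrow> (\<forall>k. z k \<in> E) \<longrightarrow>
        bounded (range (\<lambda>k. orth_proj X (x k))) \<longrightarrow>
        (\<lambda>k. f (x k) - f (z k) - G (z k) \<bullet> (x k - z k)) \<longlonglongrightarrow> 0 \<longrightarrow>
        (\<lambda>k. norm (G (x k) - G (z k))) \<longlonglongrightarrow> 0)"

definition extension_conditions ::
    "'a::euclidean_space set \<Rightarrow> 'a set \<Rightarrow> ('a \<Rightarrow> real) \<Rightarrow> ('a \<Rightarrow> 'a) \<Rightarrow> bool" where
  "extension_conditions E X f G \<longleftrightarrow>
     condition_i E f G \<and> condition_ii E X G \<and> condition_iii E X G \<and> condition_iv E X f G"

text \<open>The bound on \<open>Lip F\<close> by a multiple of the supremum of \<open>norm (G y)\<close> over \<open>E\<close> can only hold if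
  \<open>G\<close> is nonzero somewhere on \<open>E\<close> or \<open>X = {0}\<close>: otherwise it forces \<open>F\<close> to be constant, so that
  \<open>X\<^sub>F = {0}\<close>, although the conditions are satisfiable (\<open>E = {0}\<close>, \<open>f = 0\<close>, \<open>G = 0\<close>, any \<open>X\<close>).
  The statement of the bound excludes exactly this case.\<close>

lemma grad_eqI:
  assumes "GDERIV F x :> D"
  shows "grad F x = D"
  unfolding grad_def
proof (rule the_equality)
  show "GDERIV F x :> D" by (rule assms)
next
  fix D' assume "GDERIV F x :> D'"
  then have "(\<lambda>h. h \<bullet> D') = (\<lambda>h. h \<bullet> D)"
    using assms unfolding gderiv_def by (rule has_derivative_unique)
  then have "(D' - D) \<bullet> D' = (D' - D) \<bullet> D"
    by (rule fun_cong)
  then have "(D' - D) \<bullet> (D' - D) = 0"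
    by (simp add: inner_diff_right)
  then show "D' = D" by simp
qed

lemma orth_proj_eqI:
  assumes "subspace X" "y \<in> X" "x - y \<in> X\<^sup>\<bottom>"
  shows "orth_proj X x = y"
  unfolding orth_proj_def
proof (rule the_equality)
  show "y \<in> X \<and> x - y \<in> X\<^sup>\<bottom>" using assms by simp
next
  fix z assume z: "z \<in> X \<and> x - z \<in> X\<^sup>\<bottom>"
  have "z - y \<in> X" using assms z by (simp add: subspace_diff)
  moreover have "z - y \<in> X\<^sup>\<bottom>"
    using subspace_diff[OF subspace_orthogonal_comp assms(3), of "x - z"] z by simp
  ultimately have "(z - y) \<bullet> (z - y) = 0"
    by (auto simp: orthogonal_comp_def orthogonal_def)
  then show "z = y" by simp
qed

end

theory Submission
  imports Defs
begin

text \<open>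
  Sufficiency. Let \<open>m\<close> be the supremum of the affine functions given by the jets and of finitely
  many further ones; the cones of condition (iii) leave room for the latter to lie at least 1 below
  \<open>f\<close> on \<open>E\<close> while their slopes complete those of the jets to \<open>X\<close>. By (iv), \<open>m\<close> is differentiable
  on the closure \<open>K\<close> of \<open>P\<^sub>X E\<close>, and on \<open>X\<close> it is coercive up to a linear function. A convex
  function of class \<open>C\<^sup>1\<close> between \<open>m\<close> and \<open>m + (L + 1) \<theta>\<close>, where \<open>\<theta> x = min 1 (dist x K)\<^sup>2\<close>, is obtained
  without Whitney's theorem: \<open>g x = inf\<^sub>y (m y + (L + 1) |(\<theta> x, x - y)|)\<close>, with \<open>L\<close> a Lipschitz
  constant of \<open>m\<close>, is touched from above by a differentiable function at each point, and this makes
  the convex envelope of the coercive function \<open>g\<close> differentiable. As the envelope stays at bounded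
  distance from \<open>m\<close>, its slopes are no larger than those of \<open>m\<close>; the added slopes exceed the old
  ones by arbitrarily little, so \<open>C(n) = 2\<close> works.

  Necessity. \<open>X\<^sub>F\<close> is the span of all differences of gradients of \<open>F\<close>. The points \<open>p\<^sub>j\<close> are chosen so
  that the components of their gradients orthogonal to \<open>Y\<close> form a basis of the complement of \<open>Y\<close> in
  \<open>X\<close>; monotonicity of the gradient yields the cones.
\<close>

subsection \<open>Orthogonal projections and gradients\<close>

lemma orth_proj_mem:
  assumes "subspace X"
  shows "orth_proj X x \<in> X" and "x - orth_proj X x \<in> X\<^sup>\<bottom>"
proof -
  obtain y z where yz: "y \<in> span X" "\<And>w. w \<in> span X \<Longrightarrow> orthogonal z w" "x = y + z"
    using orthogonal_subspace_decomp_exists by blast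
  have "y \<in> X" "x - y \<in> X\<^sup>\<bottom>"
    using yz assms by (simp_all add: orthogonal_comp_def span_eq_iff[THEN iffD2] orthogonal_commute[of _ z])
  with orth_proj_eqI[OF assms this] show "orth_proj X x \<in> X" "x - orth_proj X x \<in> X\<^sup>\<bottom>"
    by simp_all
qed

lemma inner_orthogonal_comp: "u \<in> X \<Longrightarrow> v \<in> X\<^sup>\<bottom> \<Longrightarrow> u \<bullet> v = 0"
  "u \<in> X \<Longrightarrow> v \<in> X\<^sup>\<bottom> \<Longrightarrow> v \<bullet> u = 0"
  by (auto simp: orthogonal_comp_def orthogonal_def inner_commute)

lemma orth_proj_id: "subspace X \<Longrightarrow> x \<in> X \<Longrightarrow> orth_proj X x = x"
  by (rule orth_proj_eqI) (auto simp: subspace_orthogonal_comp subspace_0)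

lemma orth_proj_linear:
  assumes "subspace X"
  shows "linear (orth_proj X)"
proof
  fix x y :: 'a and r :: real
  show "orth_proj X (x + y) = orth_proj X x + orth_proj X y"
  proof (rule orth_proj_eqI[OF assms])
    show "orth_proj X x + orth_proj X y \<in> X"
      using assms orth_proj_mem[OF assms] by (simp add: subspace_add)
    have "(x - orth_proj X x) + (y - orth_proj X y) \<in> X\<^sup>\<bottom>"
      using orth_proj_mem[OF assms] subspace_orthogonal_comp by (blast intro: subspace_add)
    then show "x + y - (orth_proj X x + orth_proj X y) \<in> X\<^sup>\<bottom>" by (simp add: algebra_simps)
  qed
  show "orth_proj X (r *\<^sub>R x) = r *\<^sub>R orth_proj X x"
  proof (rule orth_proj_eqI[OF assms])
    show "r *\<^sub>R orth_proj X x \<in> X"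
      using assms orth_proj_mem[OF assms] by (simp add: subspace_scale)
    have "r *\<^sub>R (x - orth_proj X x) \<in> X\<^sup>\<bottom>"
      using orth_proj_mem[OF assms] subspace_orthogonal_comp by (blast intro: subspace_scale)
    then show "r *\<^sub>R x - r *\<^sub>R orth_proj X x \<in> X\<^sup>\<bottom>" by (simp add: algebra_simps)
  qed
qed

lemma inner_orth_proj:
  assumes "subspace X" "u \<in> X"
  shows "u \<bullet> orth_proj X x = u \<bullet> x"
  using inner_orthogonal_comp(1)[OF assms(2) orth_proj_mem(2)[OF assms(1), of x]]
  by (simp add: inner_diff_right)

lemma norm_orth_proj_le:
  assumes "subspace X"
  shows "norm (orth_proj X x) \<le> norm x"
proof -
  have "norm (orth_proj X x) ^ 2 = orth_proj X x \<bullet> x"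
    using inner_orth_proj[OF assms orth_proj_mem(1)[OF assms], of x x] by (simp add: power2_norm_eq_inner)
  also have "\<dots> \<le> norm (orth_proj X x) * norm x" by (rule norm_cauchy_schwarz)
  finally show ?thesis by (cases "orth_proj X x = 0") (auto simp: power2_eq_square)
qed

lemma orth_proj_orthogonal_comp:
  assumes "subspace X" "u \<in> X\<^sup>\<bottom>"
  shows "orth_proj X u = 0"
  by (rule orth_proj_eqI) (use assms in \<open>auto simp: subspace_0\<close>)

section \<open>Gradients of convex functions\<close>

lemma GDERIV_grad:
  assumes "F differentiable (at x)"
  shows "GDERIV F x :> grad F x"
proof -
  obtain D where D: "(F has_derivative D) (at x)" using assms unfolding differentiable_def by blast
  interpret D: bounded_linear D using D by (rule has_derivative_bounded_linear)
  have "D h = h \<bullet> (\<Sum>b\<in>Basis. D b *\<^sub>R b)" for h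
  proof -
    have "D h = D (\<Sum>b\<in>Basis. (h \<bullet> b) *\<^sub>R b)" by (simp add: euclidean_representation)
    also have "\<dots> = (\<Sum>b\<in>Basis. (h \<bullet> b) *\<^sub>R D b)" by (simp add: D.sum D.scaleR)
    finally show ?thesis by (simp add: inner_sum_right mult.commute)
  qed
  then have "D = (\<lambda>h. h \<bullet> (\<Sum>b\<in>Basis. D b *\<^sub>R b))" by blast
  then have "GDERIV F x :> (\<Sum>b\<in>Basis. D b *\<^sub>R b)" using D unfolding gderiv_def by simp
  then show ?thesis using grad_eqI by metis
qed

lemma gderiv_epsilonD:
  assumes "GDERIV \<psi> x :> p" "0 < e"
  obtains r where "0 < r" "\<And>h. norm h < r \<Longrightarrow> \<bar>\<psi> (x + h) - \<psi> x - p \<bullet> h\<bar> \<le> e * norm h"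
proof -
  obtain r where "0 < r" and r: "\<And>y. norm (y - x) < r \<Longrightarrow>
      norm (\<psi> y - \<psi> x - (y - x) \<bullet> p) \<le> e * norm (y - x)"
    using assms unfolding gderiv_def has_derivative_at_alt by blast
  show thesis
    by (rule that[OF \<open>0 < r\<close>]) (use r[of "x + _"] in \<open>simp add: inner_commute\<close>)
qed

text \<open>Convexity bounds the increment along \<open>h\<close> from below by minus the increment along \<open>-h\<close>, so
  a one-sided estimate suffices.\<close>

lemma convex_gderivI:
  fixes F :: "'a::real_inner \<Rightarrow> real"
  assumes F: "convex_on UNIV F"
    and up: "\<And>e. 0 < e \<Longrightarrow> \<exists>r>0. \<forall>h. norm h < r \<longrightarrow> F (x + h) \<le> F x + p \<bullet> h + e * norm h"
  shows "GDERIV F x :> p"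
  unfolding gderiv_def has_derivative_at_alt
proof (intro conjI allI impI)
  show "bounded_linear (\<lambda>h. h \<bullet> p)" by (rule bounded_linear_inner_left)
  fix e :: real assume "0 < e"
  then obtain r where "r > 0" and r: "\<And>h. norm h < r \<Longrightarrow> F (x + h) \<le> F x + p \<bullet> h + e * norm h"
    using up by blast
  have "norm (F y - F x - (y - x) \<bullet> p) \<le> e * norm (y - x)" if y: "norm (y - x) < r" for y
  proof -
    have "F ((1 - 1/2) *\<^sub>R y + (1/2) *\<^sub>R (x - (y - x))) \<le> (1 - 1/2) * F y + 1/2 * F (x - (y - x))"
      by (rule convex_onD[OF F]) auto
    moreover have "(1 - 1/2) *\<^sub>R y + (1/2::real) *\<^sub>R (x - (y - x)) = x"
      by (simp add: algebra_simps flip: scaleR_add_left)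
    ultimately have "2 * F x \<le> F y + F (x - (y - x))" by simp
    moreover have "F y \<le> F x + p \<bullet> (y - x) + e * norm (y - x)" using r[of "y - x"] y by simp
    moreover have "F (x - (y - x)) \<le> F x - p \<bullet> (y - x) + e * norm (y - x)"
      using r[of "- (y - x)"] y by (simp add: norm_minus_commute inner_diff_right algebra_simps)
    ultimately show ?thesis by (simp add: inner_commute[of _ p] abs_le_iff)
  qed
  then show "\<exists>d>0. \<forall>y. norm (y - x) < d \<longrightarrow> norm (F y - F x - (y - x) \<bullet> p) \<le> e * norm (y - x)"
    using \<open>r > 0\<close> by blast
qed

text \<open>The first-order upper bound of \<open>\<psi>\<close> at \<open>x\<close> passes to
  \<open>F\<close>, and for a convex function such a bound is already enough. Differentiability of
  the convex envelope is obtained this way.\<close>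

lemma convex_differentiable_touching_above:
  fixes F :: "'a::euclidean_space \<Rightarrow> real"
  assumes F: "convex_on UNIV F" and \<psi>: "\<psi> differentiable (at x)" "\<psi> x = F x" "\<And>y. F y \<le> \<psi> y"
  shows "F differentiable (at x)"
proof -
  have "GDERIV F x :> grad \<psi> x"
  proof (rule convex_gderivI[OF F])
    fix e :: real assume "0 < e"
    obtain r where "0 < r" and r: "\<And>h. norm h < r \<Longrightarrow> \<bar>\<psi> (x + h) - \<psi> x - grad \<psi> x \<bullet> h\<bar> \<le> e * norm h"
      using gderiv_epsilonD[OF GDERIV_grad[OF \<psi>(1)] \<open>0 < e\<close>] by blast
    have "F (x + h) \<le> F x + grad \<psi> x \<bullet> h + e * norm h" if "norm h < r" for h
      using r[OF that] \<psi>(2) \<psi>(3)[of "x + h"] by linarith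
    then show "\<exists>r>0. \<forall>h. norm h < r \<longrightarrow> F (x + h) \<le> F x + grad \<psi> x \<bullet> h + e * norm h"
      using \<open>0 < r\<close> by blast
  qed
  then show ?thesis unfolding gderiv_def differentiable_def by blast
qed

text \<open>Subtracting the linear function given by \<open>p\<close> from \<open>F\<close> leaves a
  function with a minimum at \<open>x\<close>, where the derivative vanishes.\<close>

lemma grad_eq_subgradient:
  assumes F: "F differentiable (at x)" and p: "\<And>y. F y \<ge> F x + p \<bullet> (y - x)"
  shows "grad F x = p"
proof -
  have "((\<lambda>y. F y - p \<bullet> y) has_derivative (\<lambda>h. h \<bullet> grad F x - p \<bullet> h)) (at x)"
    using GDERIV_grad[OF F] unfolding gderiv_def by (auto intro!: derivative_eq_intros)
  moreover have "F x - p \<bullet> x \<le> F y - p \<bullet> y" for y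
    using p[of y] by (simp add: inner_diff_right)
  ultimately have "(\<lambda>h. h \<bullet> grad F x - p \<bullet> h) = (\<lambda>h. 0)"
    by (rule has_derivative_local_min[OF _ always_eventually, rule_format])
  then have "(grad F x - p) \<bullet> grad F x - p \<bullet> (grad F x - p) = 0" by (rule fun_cong)
  then have "(grad F x - p) \<bullet> (grad F x - p) = 0"
    using inner_commute[of p "grad F x"] by (simp add: inner_diff_right inner_diff_left)
  then show ?thesis by simp
qed

text \<open>Along the segment from \<open>x\<close> to \<open>y\<close>, convexity bounds the
  difference quotient at a small parameter \<open>t\<close> by \<open>F y - F x\<close>, while
  differentiability makes the quotient almost \<open>grad F x \<bullet> (y - x)\<close>.\<close>

lemma convex_tangent_le:
  assumes F: "convex_on UNIV F" and d: "F differentiable (at x)"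
  shows "F y \<ge> F x + grad F x \<bullet> (y - x)"
proof (rule field_le_epsilon)
  fix e :: real assume "0 < e"
  define e' where "e' = e / (norm (y - x) + 1)"
  have "0 < e'" using \<open>0 < e\<close> by (simp add: e'_def add_nonneg_pos)
  have e': "e' * norm (y - x) \<le> e"
    using \<open>0 < e\<close> by (simp add: e'_def add_nonneg_pos pos_divide_le_eq)
  obtain r where "0 < r" and r: "\<And>h. norm h < r \<Longrightarrow> \<bar>F (x + h) - F x - grad F x \<bullet> h\<bar> \<le> e' * norm h"
    using gderiv_epsilonD[OF GDERIV_grad[OF d] \<open>0 < e'\<close>] by blast
  \<comment> \<open>The factor keeps \<open>x + t *\<^sub>R (y - x)\<close> within distance
    \<open>r\<close> of \<open>x\<close>; the \<open>+ 1\<close> covers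
    \<open>y = x\<close>.\<close>
  define t where "t = min 1 (r / (2 * (norm (y - x) + 1)))"
  have t: "0 < t" "t \<le> 1" "t * norm (y - x) < r"
  proof -
    show "0 < t" using \<open>0 < r\<close> by (simp add: t_def add_nonneg_pos)
    have "t * norm (y - x) \<le> r / (2 * (norm (y - x) + 1)) * norm (y - x)"
      by (rule mult_right_mono) (auto simp: t_def)
    also have "\<dots> = r * (norm (y - x) / (2 * (norm (y - x) + 1)))" by simp
    also have "\<dots> < r * 1"
      using \<open>0 < r\<close>
      by (intro mult_strict_left_mono) (simp_all add: pos_divide_less_eq add_nonneg_pos)
    also have "r * 1 = r" by simp
    finally show "t * norm (y - x) < r" .
  qed (simp add: t_def)
  have "F ((1 - t) *\<^sub>R x + t *\<^sub>R y) \<le> (1 - t) * F x + t * F y"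
    using t by (intro convex_onD[OF F]) auto
  moreover have "(1 - t) *\<^sub>R x + t *\<^sub>R y = x + t *\<^sub>R (y - x)" by (simp add: algebra_simps)
  moreover have "F (x + t *\<^sub>R (y - x)) \<ge> F x + t * (grad F x \<bullet> (y - x)) - e' * (t * norm (y - x))"
    using r[of "t *\<^sub>R (y - x)"] t by simp
  ultimately have "t * (grad F x \<bullet> (y - x)) \<le> t * (F y - F x + e' * norm (y - x))"
    by (simp add: algebra_simps)
  then have "grad F x \<bullet> (y - x) \<le> F y - F x + e' * norm (y - x)"
    using t by simp
  then show "F x + grad F x \<bullet> (y - x) \<le> F y + e" using e' by simp
qed

text \<open>Testing the approximate subgradient inequality at fixed distance from \<open>s k\<close>
  bounds \<open>q k - grad F x\<close> by the first-order error at \<open>x\<close> and terms that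
  tend to 0. With zero error this yields continuity of the gradient; the errors
  \<open>\<epsilon> k\<close> are there for the necessity of condition (iv).\<close>

lemma approx_subgradients_tendsto_grad:
  fixes F :: "'a::euclidean_space \<Rightarrow> real" and s q :: "nat \<Rightarrow> 'a"
  assumes d: "F differentiable (at x)" and L: "L-lipschitz_on UNIV F"
    and x: "s \<longlonglongrightarrow> x" and e: "\<epsilon> \<longlonglongrightarrow> 0"
    and q: "\<And>k y. F y \<ge> F (s k) + q k \<bullet> (y - s k) - \<epsilon> k"
  shows "q \<longlonglongrightarrow> grad F x"
proof (rule LIMSEQ_I)
  fix \<eta> :: real assume "0 < \<eta>"
  obtain r where "0 < r" and r: "\<And>h. norm h < r \<Longrightarrow> \<bar>F (x + h) - F x - grad F x \<bullet> h\<bar> \<le> \<eta> / 2 * norm h"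
    using gderiv_epsilonD[OF GDERIV_grad[OF d], of "\<eta> / 2"] \<open>0 < \<eta>\<close> by auto
  define t where "t = r / 2"
  have t: "0 < t" "t < r" using \<open>0 < r\<close> by (auto simp: t_def)
  have lip: "\<bar>F a - F b\<bar> \<le> L * norm (a - b)" for a b
    using lipschitz_onD[OF L, of a b] by (simp add: dist_norm)
  have key: "t * norm (q k - grad F x) \<le> \<eta> / 2 * t + 2 * L * norm (s k - x) + \<epsilon> k" for k
  proof -
    \<comment> \<open>The step points along \<open>q k - grad F x\<close>, where the two slopes
      disagree most, and its length \<open>t\<close> does not depend on \<open>k\<close>.\<close>
    define h where "h = t *\<^sub>R sgn (q k - grad F x)"
    show ?thesis
    proof (cases "q k = grad F x")
      case True
      have "0 \<le> \<epsilon> k" using q[of k "s k"] by simp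
      moreover have "0 \<le> L * norm (s k - x)" using lip[of "s k" x] by linarith
      ultimately show ?thesis using True \<open>0 < \<eta>\<close> t by simp
    next
      case False
      have h: "norm h = t" using False t by (simp add: h_def norm_sgn)
      have "(q k - grad F x) \<bullet> h = t * norm (q k - grad F x)"
        using False by (simp add: h_def sgn_div_norm dot_square_norm power2_eq_square del: inner_diff_left inner_diff_right)
      moreover have "q k \<bullet> h \<le> F (s k + h) - F (s k) + \<epsilon> k" using q[of k "s k + h"] by simp
      moreover have "F (s k + h) - F (s k) \<le> F (x + h) - F x + 2 * L * norm (s k - x)"
        using lip[of "s k + h" "x + h"] lip[of "s k" x] by simp
      moreover have "F (x + h) - F x \<le> grad F x \<bullet> h + \<eta> / 2 * t" using abs_le_D1[OF r[of h]] h t by simp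
      ultimately show ?thesis by (simp add: inner_diff_left)
    qed
  qed
  have "(\<lambda>k. 2 * L * norm (s k - x) + \<epsilon> k) \<longlonglongrightarrow> 2 * L * norm (x - x) + 0"
    by (intro tendsto_intros x e)
  then have "(\<lambda>k. 2 * L * norm (s k - x) + \<epsilon> k) \<longlonglongrightarrow> 0" by simp
  moreover have "0 < \<eta> / 2 * t" using t \<open>0 < \<eta>\<close> by simp
  ultimately have "eventually (\<lambda>k. 2 * L * norm (s k - x) + \<epsilon> k < \<eta> / 2 * t) sequentially"
    by (rule order_tendstoD)
  then have "eventually (\<lambda>k. norm (q k - grad F x) < \<eta>) sequentially"
  proof eventually_elim
    case (elim k)
    then have "t * norm (q k - grad F x) < t * \<eta>"
      using key[of k] by (simp only: mult.commute[of t \<eta>])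
    then show ?case using t by simp
  qed
  then show "\<exists>no. \<forall>n\<ge>no. norm (q n - grad F x) < \<eta>" by (simp add: eventually_sequentially)
qed

lemma convex_lipschitz_grad_continuous:
  fixes F :: "'a::euclidean_space \<Rightarrow> real"
  assumes F: "convex_on UNIV F" and d: "\<And>x. F differentiable (at x)" and L: "L-lipschitz_on UNIV F"
  shows "continuous_on UNIV (grad F)"
  unfolding continuous_on_sequentially
proof (intro allI ballI impI)
  fix s :: "nat \<Rightarrow> 'a" and x assume "(\<forall>n. s n \<in> UNIV) \<and> s \<longlonglongrightarrow> x"
  then have "(\<lambda>k. grad F (s k)) \<longlonglongrightarrow> grad F x"
    by (intro approx_subgradients_tendsto_grad[OF d L, of s x "\<lambda>_. 0"])
       (use convex_tangent_le[OF F d] in auto)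
  then show "(grad F \<circ> s) \<longlonglongrightarrow> grad F x" by (simp add: o_def)
qed

section \<open>Gradient bounds and the best Lipschitz constant\<close>

text \<open>On the ray from \<open>x\<close> along its gradient, the tangent grows at rate
  \<open>norm (grad F x)\<close>, which the growth bound caps at \<open>M\<close>. Since
  \<open>C\<close> is arbitrary, a bounded perturbation of an \<open>M\<close>-Lipschitz function
  keeps the gradient bound \<open>M\<close>.\<close>

lemma norm_grad_le_growth:
  assumes F: "convex_on UNIV F" and d: "F differentiable (at x)"
    and M: "0 \<le> M" "\<And>y. F y \<le> M * norm y + C"
  shows "norm (grad F x) \<le> M"
proof (rule ccontr)
  define n where "n = norm (grad F x)"
  assume "\<not> norm (grad F x) \<le> M"
  then have n: "M < n" by (simp add: n_def)
  define u where "u = sgn (grad F x)"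
  have "grad F x \<noteq> 0" using n \<open>0 \<le> M\<close> by (auto simp: n_def)
  then have u: "norm u = 1" "grad F x \<bullet> u = n"
    by (simp_all add: n_def u_def norm_sgn) (simp add: sgn_div_norm power2_norm_eq_inner[symmetric] power2_eq_square)
  define K where "K = M * norm x + C - F x"
  have *: "t * (n - M) \<le> K" if "0 \<le> t" for t
  proof -
    have "F x + t * n \<le> F (x + t *\<^sub>R u)" using convex_tangent_le[OF F d, of "x + t *\<^sub>R u"] u by simp
    also have "\<dots> \<le> M * norm (x + t *\<^sub>R u) + C" by (rule M)
    also have "\<dots> \<le> M * (norm x + t) + C"
      using norm_triangle_ineq[of x "t *\<^sub>R u"] u that M by (simp add: mult_left_mono)
    finally show ?thesis by (simp add: K_def algebra_simps)
  qed
  have "0 \<le> K" using *[of 0] by simp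
  then have "(K + 1) / (n - M) * (n - M) \<le> K" using n by (intro *) auto
  then show False using n by simp
qed

lemma lipschitz_of_grad_le:
  assumes d: "\<And>x. F differentiable (at x)" and "\<And>x. norm (grad F x) \<le> M"
  shows "M-lipschitz_on UNIV F"
proof -
  have "onorm (\<lambda>h. h \<bullet> grad F x) \<le> M" for x
  proof (rule onorm_le)
    fix h
    have "norm (h \<bullet> grad F x) \<le> norm h * norm (grad F x)" by (simp add: Cauchy_Schwarz_ineq2)
    also have "\<dots> \<le> norm h * M" using assms(2) by (rule mult_left_mono) simp
    finally show "norm (h \<bullet> grad F x) \<le> M * norm h" by (simp only: mult.commute)
  qed
  then show ?thesis
    using order_trans[OF norm_ge_zero assms(2)[of 0]]
    by (intro bounded_derivative_imp_lipschitz[where f' = "\<lambda>x h. h \<bullet> grad F x"])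
       (use GDERIV_grad[OF d] in \<open>auto simp: gderiv_def\<close>)
qed

lemma norm_grad_le_lipschitz:
  assumes F: "convex_on UNIV F" and d: "F differentiable (at x)" and L: "L-lipschitz_on UNIV F"
  shows "norm (grad F x) \<le> L"
proof (rule norm_grad_le_growth[OF F d])
  show "0 \<le> L" using L by (rule lipschitz_on_nonneg)
  fix y show "F y \<le> L * norm y + F 0"
    using lipschitz_onD[OF L, of y 0] by (simp add: dist_norm)
qed

text \<open>The Lipschitz constants of \<open>F\<close> are exactly the upper bounds of the gradient
  norms, so they form a closed ray starting at the supremum.\<close>

lemma Lip_eq_SUP_grad:
  assumes F: "convex_on UNIV F" and d: "\<And>x. F differentiable (at x)" and L: "L-lipschitz_on UNIV F"
  shows "Lip F = (SUP x. norm (grad F x))"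
proof -
  let ?S = "SUP x. norm (grad F x)"
  have bdd: "bdd_above (range (\<lambda>x. norm (grad F x)))"
    using norm_grad_le_lipschitz[OF F d L] by (auto intro: bdd_aboveI[of _ L])
  have "{L. L-lipschitz_on UNIV F} = {?S..}"
  proof (intro set_eqI iffI)
    fix L assume "L \<in> {L. L-lipschitz_on UNIV F}"
    then show "L \<in> {?S..}" using norm_grad_le_lipschitz[OF F d] by (auto intro: cSUP_least)
  next
    fix L assume "L \<in> {?S..}"
    then have "norm (grad F x) \<le> L" for x using cSUP_upper[OF _ bdd, of x] by simp
    then show "L \<in> {L. L-lipschitz_on UNIV F}" using lipschitz_of_grad_le[OF d] by blast
  qed
  then show ?thesis by (simp add: Lip_def)
qed

subsection \<open>Convex envelopes\<close>

text \<open>By Caratheodory's theorem at most \<open>DIM('b) + 1\<close> points are involved, so one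
  of their weights is at least the average. This uniform lower bound survives passage to
  limits.\<close>

lemma convex_hull_heavy_point:
  fixes S :: "'b::euclidean_space set"
  assumes "y \<in> convex hull S"
  obtains a b l where "a \<in> S" "b \<in> convex hull S" "1 / real (DIM('b) + 1) \<le> l" "l \<le> 1"
    "y = l *\<^sub>R a + (1 - l) *\<^sub>R b"
proof -
  let ?N = "real (DIM('b) + 1)"
  obtain T u where T: "finite T" "T \<subseteq> S" "card T \<le> DIM('b) + 1" "\<forall>x\<in>T. 0 \<le> u x"
      "sum u T = 1" "(\<Sum>v\<in>T. u v *\<^sub>R v) = y"
    using assms unfolding convex_hull_caratheodory by blast
  have "\<exists>a\<in>T. 1 / ?N \<le> u a"
  proof (rule ccontr)
    assume "\<not> ?thesis"
    then have "sum u T < (\<Sum>a\<in>T. 1 / ?N)"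
      using T by (intro sum_strict_mono) auto
    also have "\<dots> = real (card T) / ?N" by simp
    also have "\<dots> \<le> 1" using T(3) by (simp add: divide_le_eq)
    finally show False using T by simp
  qed
  then obtain a where a: "a \<in> T" "1 / ?N \<le> u a" by blast
  have rest: "sum u (T - {a}) = 1 - u a" "y = u a *\<^sub>R a + (\<Sum>v\<in>T - {a}. u v *\<^sub>R v)"
    using T a by (simp_all add: sum.remove[of T a])
  have nn: "0 \<le> sum u (T - {a})" using T by (intro sum_nonneg) auto
  show thesis
  proof (cases "u a = 1")
    \<comment> \<open>All weight sits at \<open>a\<close>, so there is no remaining combination to
      normalize and \<open>b = a\<close> is taken.\<close>
    case True
    have "sum u (T - {a}) = 0" using rest True by simp
    then have "\<forall>v\<in>T - {a}. u v = 0"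
      using T sum_nonneg_eq_0_iff[of "T - {a}" u] by simp
    then have "y = u a *\<^sub>R a + (1 - u a) *\<^sub>R a" using rest True by simp
    moreover have "a \<in> S" using a T by blast
    ultimately show thesis using that[of a a "u a"] a True by (simp add: hull_inc)
  next
    case False
    then have pos: "0 < 1 - u a" using nn rest by simp
    define b where "b = (\<Sum>v\<in>T - {a}. (u v / (1 - u a)) *\<^sub>R v)"
    have "b \<in> convex hull S" unfolding b_def
    proof (rule convex_sum)
      show "(\<Sum>v\<in>T - {a}. u v / (1 - u a)) = 1"
        using rest pos by (simp flip: sum_divide_distrib)
    qed (use T pos in \<open>auto simp: hull_inc convex_convex_hull\<close>)
    moreover have "(1 - u a) *\<^sub>R b = (\<Sum>v\<in>T - {a}. u v *\<^sub>R v)"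
      using pos by (simp add: b_def scaleR_sum_right)
    ultimately show thesis using that[of a b "u a"] a T rest pos by auto
  qed
qed

text \<open>The envelope is the lower boundary of the convex hull of the epigraph, which makes
  Caratheodory's theorem in the product space available for it.\<close>

definition convex_envelope :: "('a::euclidean_space \<Rightarrow> real) \<Rightarrow> 'a \<Rightarrow> real" where
  "convex_envelope g x = Inf {t. (x, t) \<in> convex hull (epigraph UNIV g)}"

text \<open>The epigraph of \<open>m\<close> is convex and contains that of \<open>g\<close>, hence
  also its convex hull.\<close>

lemma hull_epigraph_minorant:
  assumes "convex_on UNIV m" "\<And>x. m x \<le> g x" "(x, t) \<in> convex hull (epigraph UNIV g)"
  shows "m x \<le> t"
proof -
  have "convex hull (epigraph UNIV g) \<subseteq> epigraph UNIV m"
  proof (rule hull_minimal)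
    show "epigraph UNIV g \<subseteq> epigraph UNIV m"
      using assms(2) by (auto simp: epigraph_def intro: order_trans)
    show "convex (epigraph UNIV m)" using assms(1) by (simp add: convex_epigraph)
  qed
  then show ?thesis using assms(3) by (auto simp: epigraph_def)
qed

context
  fixes g :: "'a::euclidean_space \<Rightarrow> real" and c :: real
  assumes lower: "\<And>x. c \<le> g x"
begin

lemma envelope_bdd: "(x, t) \<in> convex hull (epigraph UNIV g) \<Longrightarrow> c \<le> t"
  by (rule hull_epigraph_minorant[where m = "\<lambda>_. c"]) (auto simp: lower convex_on_const)

lemma in_hull_epigraph: "g x \<le> t \<Longrightarrow> (x, t) \<in> convex hull (epigraph UNIV g)"
  by (rule hull_inc) (simp add: epigraph_def)

lemma envelope_le: "(x, t) \<in> convex hull (epigraph UNIV g) \<Longrightarrow> convex_envelope g x \<le> t"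
  unfolding convex_envelope_def
  by (rule cInf_lower) (auto intro!: bdd_belowI[of _ c] dest: envelope_bdd)

lemma envelope_le_fun: "convex_envelope g x \<le> g x"
  by (intro envelope_le in_hull_epigraph) simp

lemma envelope_approx:
  assumes "0 < e"
  obtains t where "(x, t) \<in> convex hull (epigraph UNIV g)" "t < convex_envelope g x + e"
proof -
  have "Inf {t. (x, t) \<in> convex hull (epigraph UNIV g)} < convex_envelope g x + e"
    using assms by (simp add: convex_envelope_def)
  moreover have "{t. (x, t) \<in> convex hull (epigraph UNIV g)} \<noteq> {}"
    using in_hull_epigraph by blast
  ultimately obtain t where "t \<in> {t. (x, t) \<in> convex hull (epigraph UNIV g)}"
      "t < convex_envelope g x + e"
    using cInf_lessD[of "{t. (x, t) \<in> convex hull (epigraph UNIV g)}"] by blast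
  then show thesis using that by simp
qed

lemma envelope_greatest:
  assumes "convex_on UNIV m" "\<And>x. m x \<le> g x"
  shows "m x \<le> convex_envelope g x"
  unfolding convex_envelope_def
proof (rule cInf_greatest)
  show "{t. (x, t) \<in> convex hull (epigraph UNIV g)} \<noteq> {}"
    using in_hull_epigraph by blast
qed (use hull_epigraph_minorant[OF assms] in blast)

lemma convex_on_envelope: "convex_on UNIV (convex_envelope g)"
proof (rule convex_onI)
  fix t :: real and x y :: 'a
  assume t: "0 < t" "t < 1"
  show "convex_envelope g ((1 - t) *\<^sub>R x + t *\<^sub>R y)
      \<le> (1 - t) * convex_envelope g x + t * convex_envelope g y"
  proof (rule field_le_epsilon)
    fix e :: real assume "0 < e"
    obtain r s where r: "(x, r) \<in> convex hull (epigraph UNIV g)" "r < convex_envelope g x + e"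
      and s: "(y, s) \<in> convex hull (epigraph UNIV g)" "s < convex_envelope g y + e"
      using envelope_approx[OF \<open>0 < e\<close>] by metis
    have "(1 - t) *\<^sub>R (x, r) + t *\<^sub>R (y, s) \<in> convex hull (epigraph UNIV g)"
      using t r s by (intro convexD convex_convex_hull) auto
    then have "convex_envelope g ((1 - t) *\<^sub>R x + t *\<^sub>R y) \<le> (1 - t) * r + t * s"
      by (intro envelope_le) simp
    also have "\<dots> \<le> (1 - t) * (convex_envelope g x + e) + t * (convex_envelope g y + e)"
      using t r s by (intro add_mono mult_left_mono) auto
    finally show "convex_envelope g ((1 - t) *\<^sub>R x + t *\<^sub>R y)
        \<le> (1 - t) * convex_envelope g x + t * convex_envelope g y + e"
      by (simp add: algebra_simps)
  qed
qed simp

text \<open>In an almost optimal convex combination some point has weight bounded from below; by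
  coercivity such points have a limit \<open>a\<close>. Moving only this point shows that the envelope near
  \<open>x\<close> lies below a rescaled copy of \<open>g\<close> near \<open>a\<close>.\<close>

lemma envelope_translate_bound:
  assumes g: "continuous_on UNIV g" and coer: "\<And>C. bounded {x. g x \<le> C}"
  obtains l a where "0 < l"
    "\<And>h. convex_envelope g (x + h) \<le> convex_envelope g x + l * (g (a + h /\<^sub>R l) - g a)"
proof -
  let ?H = "convex hull (epigraph UNIV g)" and ?F = "convex_envelope g"
  \<comment> \<open>Caratheodory's number for the product space in which the epigraph lies; some
    weight is at least \<open>1 / N\<close>.\<close>
  define N where "N = real (DIM('a \<times> real) + 1)"
  have N: "0 < N" by (simp add: N_def)
  have "\<exists>t l a. l \<in> {1 / N..1} \<and> g a \<le> (\<bar>?F x\<bar> + 1 + \<bar>c\<bar>) * N + \<bar>c\<bar> \<and> ?F x \<le> t \<and> t < ?F x + inverse (real (Suc k)) \<and>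
      (\<forall>h. ?F (x + h) \<le> t + l * (g (a + h /\<^sub>R l) - g a))" for k
  proof -
    obtain t where t: "(x, t) \<in> ?H" "t < ?F x + inverse (real (Suc k))"
      using envelope_approx[of "inverse (real (Suc k))"] by auto
    obtain p q l where pq: "p \<in> epigraph UNIV g" "q \<in> ?H" and l: "1 / N \<le> l" "l \<le> 1"
      and xt: "(x, t) = l *\<^sub>R p + (1 - l) *\<^sub>R q"
      using convex_hull_heavy_point[OF t(1)] unfolding N_def by metis
    obtain a s b r where p: "p = (a, s)" and q: "q = (b, r)" by fastforce
    have "0 < l" using l N by (meson divide_pos_pos less_le_trans zero_less_one)
    have s: "g a \<le> s" using pq p by (simp add: epigraph_def)
    have r: "c \<le> r" using envelope_bdd pq q by blast
    have x: "x = l *\<^sub>R a + (1 - l) *\<^sub>R b" and te: "t = l * s + (1 - l) * r" using xt p q by auto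
    have "?F (x + h) \<le> t + l * (g (a + h /\<^sub>R l) - g a)" for h
    proof -
      \<comment> \<open>Only the heavy point moves: a shift by \<open>h /\<^sub>R l\<close> with
        weight \<open>l\<close> shifts the combination by \<open>h\<close>.\<close>
      have "(a + h /\<^sub>R l, s + (g (a + h /\<^sub>R l) - g a)) \<in> ?H"
        using s by (intro in_hull_epigraph) simp
      then have "l *\<^sub>R (a + h /\<^sub>R l, s + (g (a + h /\<^sub>R l) - g a)) + (1 - l) *\<^sub>R q \<in> ?H"
        using l \<open>0 < l\<close> pq by (intro convexD convex_convex_hull) auto
      moreover have "l *\<^sub>R (a + h /\<^sub>R l, s + (g (a + h /\<^sub>R l) - g a)) + (1 - l) *\<^sub>R q
          = (x + h, t + l * (g (a + h /\<^sub>R l) - g a))"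
        using \<open>0 < l\<close> by (simp add: q x te algebra_simps)
      ultimately show ?thesis using envelope_le by simp
    qed
    moreover have "?F x \<le> t" using t envelope_le by blast
    \<comment> \<open>The rest of the combination is bounded below by \<open>c\<close> and the
      weight of \<open>a\<close> by \<open>1 / N\<close>. This bounds \<open>g a\<close>
      independently of \<open>k\<close>, so coercivity keeps the points in a bounded set.\<close>
    moreover have "g a \<le> (\<bar>?F x\<bar> + 1 + \<bar>c\<bar>) * N + \<bar>c\<bar>"
    proof -
      have "inverse (real (Suc k)) \<le> 1" by (simp add: inverse_le_1_iff)
      then have "t \<le> \<bar>?F x\<bar> + 1" using t by linarith
      moreover have "- \<bar>c\<bar> \<le> (1 - l) * r"
      proof -
        have "(1 - l) * c \<le> (1 - l) * r" using l r by (intro mult_left_mono) auto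
        moreover have "(1 - l) * \<bar>c\<bar> \<le> 1 * \<bar>c\<bar>" using l \<open>0 < l\<close> by (intro mult_right_mono) auto
        moreover have "- ((1 - l) * \<bar>c\<bar>) \<le> (1 - l) * c"
          using l by (metis abs_ge_minus_self minus_le_iff mult_left_mono mult_minus_right diff_ge_0_iff_ge)
        ultimately show ?thesis by linarith
      qed
      ultimately have "l * s \<le> \<bar>?F x\<bar> + 1 + \<bar>c\<bar>" using te by linarith
      then have "s \<le> (\<bar>?F x\<bar> + 1 + \<bar>c\<bar>) * N + \<bar>c\<bar>"
      proof (cases "0 \<le> s")
        case True
        then have "1 / N * s \<le> l * s" using l by (intro mult_right_mono) auto
        with \<open>l * s \<le> _\<close> have "1 / N * s \<le> \<bar>?F x\<bar> + 1 + \<bar>c\<bar>" by linarith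
        then have "s \<le> (\<bar>?F x\<bar> + 1 + \<bar>c\<bar>) * N" using N by (simp add: pos_divide_le_eq)
        then show ?thesis by linarith
      next
        case False
        moreover have "0 \<le> (\<bar>?F x\<bar> + 1 + \<bar>c\<bar>) * N" using N by simp
        ultimately show ?thesis by linarith
      qed
      then show ?thesis using s by simp
    qed
    ultimately show ?thesis using l t by (intro exI[of _ t] exI[of _ l] exI[of _ a]) auto
  qed
  then obtain t l a where *: "\<And>k. l k \<in> {1 / N..1}" "\<And>k. g (a k) \<le> (\<bar>?F x\<bar> + 1 + \<bar>c\<bar>) * N + \<bar>c\<bar>"
      "\<And>k. ?F x \<le> t k" "\<And>k. t k < ?F x + inverse (real (Suc k))"
      "\<And>k h. ?F (x + h) \<le> t k + l k * (g (a k + h /\<^sub>R l k) - g (a k))"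
    by metis
  have "t \<longlonglongrightarrow> ?F x"
  proof (rule tendsto_sandwich[OF _ _ tendsto_const])
    show "(\<lambda>k. ?F x + inverse (real (Suc k))) \<longlonglongrightarrow> ?F x"
      using tendsto_add[OF tendsto_const LIMSEQ_inverse_real_of_nat] by simp
  qed (use * in \<open>auto intro!: always_eventually less_imp_le\<close>)
  have "bounded (range a)"
    by (rule bounded_subset[OF coer]) (use *(2) in auto)
  \<comment> \<open>Treating weight and point as one pair gives a common convergent
    subsequence.\<close>
  then have "bounded (range (\<lambda>k. (l k, a k)))"
    using *(1) by (intro bounded_subset[OF bounded_Times[OF bounded_closed_interval[of "1/N" 1]]]) auto
  then obtain la r where r: "strict_mono r" "((\<lambda>k. (l k, a k)) \<circ> r) \<longlonglongrightarrow> la"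
    using bounded_imp_convergent_subsequence by blast
  define l' where "l' = fst la"
  define a' where "a' = snd la"
  have l': "(\<lambda>k. l (r k)) \<longlonglongrightarrow> l'" and a': "(\<lambda>k. a (r k)) \<longlonglongrightarrow> a'"
    using tendsto_fst[OF r(2)] tendsto_snd[OF r(2)] by (auto simp: o_def l'_def a'_def)
  have t': "(\<lambda>k. t (r k)) \<longlonglongrightarrow> ?F x"
    using LIMSEQ_subseq_LIMSEQ[OF \<open>t \<longlonglongrightarrow> _\<close> r(1)] by (simp add: o_def)
  \<comment> \<open>The lower bound on the weights keeps the limit weight positive, so division by
    the weights is continuous in the limit.\<close>
  have "1 / N \<le> l'" using *(1) by (intro LIMSEQ_le_const[OF l']) auto
  then have "0 < l'" using N by (meson divide_pos_pos less_le_trans zero_less_one)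
  have gc: "isCont g y" for y using g by (simp add: continuous_on_eq_continuous_at)
  have "?F (x + h) \<le> ?F x + l' * (g (a' + h /\<^sub>R l') - g a')" for h
  proof (rule LIMSEQ_le_const)
    show "(\<lambda>k. t (r k) + l (r k) * (g (a (r k) + h /\<^sub>R l (r k)) - g (a (r k))))
        \<longlonglongrightarrow> ?F x + l' * (g (a' + h /\<^sub>R l') - g a')"
      using \<open>0 < l'\<close> by (intro tendsto_intros t' l' a' isCont_tendsto_compose[OF gc]) auto
  qed (use *(5) in blast)
  then show thesis using that \<open>0 < l'\<close> by blast
qed

text \<open>A function touching \<open>g\<close> from above at \<open>a\<close>, rescaled by
  \<open>l\<close> as in the translate bound, touches the envelope from above at
  \<open>x\<close>.\<close>

lemma envelope_differentiable:
  assumes g: "continuous_on UNIV g" and coer: "\<And>C. bounded {x. g x \<le> C}"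
    and touch: "\<And>x. \<exists>\<psi>. \<psi> differentiable (at x) \<and> \<psi> x = g x \<and> (\<forall>y. g y \<le> \<psi> y)"
  shows "convex_envelope g differentiable (at x)"
proof -
  obtain l a where l: "0 < l"
    and la: "\<And>h. convex_envelope g (x + h) \<le> convex_envelope g x + l * (g (a + h /\<^sub>R l) - g a)"
    using envelope_translate_bound[OF g coer] by blast
  obtain \<psi> where \<psi>: "\<psi> differentiable (at a)" "\<psi> a = g a" "\<And>y. g y \<le> \<psi> y"
    using touch by blast
  let ?\<Psi> = "\<lambda>y. convex_envelope g x + l * (\<psi> (a + (y - x) /\<^sub>R l) - g a)"
  show ?thesis
  proof (rule convex_differentiable_touching_above[OF convex_on_envelope])
    have "\<psi> \<circ> (\<lambda>y. a + (y - x) /\<^sub>R l) differentiable (at x)"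
      by (rule differentiable_chain_at) (use \<psi>(1) in \<open>auto intro!: derivative_intros\<close>)
    then have "(\<lambda>y. \<psi> (a + (y - x) /\<^sub>R l)) differentiable (at x)" by (simp add: o_def)
    then show "?\<Psi> differentiable (at x)" by (intro derivative_intros) auto
    show "?\<Psi> x = convex_envelope g x" using \<psi> by simp
    fix y
    have "l * g (a + (y - x) /\<^sub>R l) \<le> l * \<psi> (a + (y - x) /\<^sub>R l)"
      using \<psi>(3) l by (intro mult_left_mono) auto
    then show "convex_envelope g y \<le> ?\<Psi> y"
      using la[of "y - x"] by (simp add: right_diff_distrib)
  qed
qed

end

subsection \<open>Smoothing a convex function away from a closed set\<close>

lemma norm_Pair_mono: "0 \<le> s \<Longrightarrow> s \<le> t \<Longrightarrow> norm (s::real, v) \<le> norm (t, v)"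
  by (simp add: norm_Pair power_mono)

context
  fixes m :: "'a::euclidean_space \<Rightarrow> real" and K :: "'a set" and L \<eta> C :: real
  assumes convex_m: "convex_on UNIV m"
    and lip: "L-lipschitz_on UNIV m"
    and \<eta>: "0 < \<eta>" and coercive: "\<And>x. \<eta> * norm x - C \<le> m x"
    and K: "closed K" "K \<noteq> {}"
    and diff: "\<And>z. z \<in> K \<Longrightarrow> m differentiable (at z)"
begin

text \<open>The square lets the squared distance to a nearest point of \<open>K\<close> touch
  \<open>\<theta>\<close> from above; the cap at 1 bounds \<open>g - m\<close>.\<close>

private definition \<theta> :: "'a \<Rightarrow> real" where "\<theta> x = min 1 ((infdist x K)\<^sup>2)"

text \<open>Any slope above \<open>L\<close> prevents the infimum defining \<open>g\<close> from
  drifting away from \<open>x\<close>, and gives \<open>m \<le> g\<close>.\<close>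

private definition A :: real where "A = L + 1"

private lemma A_pos: "0 < A"
  using lipschitz_on_nonneg[OF lip] by (simp add: A_def)

private lemma m_lip: "m x \<le> m y + L * norm (x - y)"
  using lipschitz_onD[OF lip, of x y] by (simp add: dist_norm)

private lemma \<theta>_nonneg: "0 \<le> \<theta> x" and \<theta>_le_1: "\<theta> x \<le> 1"
  by (auto simp: \<theta>_def)

private lemma \<theta>_le: "z \<in> K \<Longrightarrow> \<theta> y \<le> (y - z) \<bullet> (y - z)"
proof -
  assume "z \<in> K"
  then have "(infdist y K)\<^sup>2 \<le> (norm (y - z))\<^sup>2"
    using infdist_le[of z K y] by (intro power_mono) (auto simp: infdist_nonneg dist_norm)
  then show ?thesis by (simp add: \<theta>_def power2_norm_eq_inner)
qed

text \<open>Moving from \<open>x\<close> to \<open>y\<close> gains at most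
  \<open>L * norm (x - y)\<close> in \<open>m\<close> but costs at least
  \<open>A * norm (x - y)\<close>. Outside the ball of radius \<open>A * \<theta> x\<close> this is
  worse than staying at \<open>x\<close>, so a minimum over the compact ball is global.\<close>

private lemma minimizer_exists:
  "\<exists>y0. \<forall>y. m y0 + A * norm (\<theta> x, x - y0) \<le> m y + A * norm (\<theta> x, x - y)"
proof -
  let ?\<phi> = "\<lambda>y. m y + A * norm (\<theta> x, x - y)"
  have "continuous_on (cball x (A * \<theta> x)) m"
    using lipschitz_on_continuous_on[OF lip] by (rule continuous_on_subset) simp
  then have "continuous_on (cball x (A * \<theta> x)) ?\<phi>"
    by (intro continuous_intros)
  moreover have "x \<in> cball x (A * \<theta> x)" using A_pos \<theta>_nonneg by simp
  ultimately have "\<exists>y0\<in>cball x (A * \<theta> x). \<forall>y\<in>cball x (A * \<theta> x). ?\<phi> y0 \<le> ?\<phi> y"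
    by (intro continuous_attains_inf) (simp, blast)
  then obtain y0 where y0: "\<And>y. y \<in> cball x (A * \<theta> x) \<Longrightarrow> ?\<phi> y0 \<le> ?\<phi> y" by blast
  have "?\<phi> y0 \<le> ?\<phi> y" if "y \<notin> cball x (A * \<theta> x)" for y
  proof -
    have "?\<phi> y0 \<le> m x + A * \<theta> x"
      using y0[OF \<open>x \<in> _\<close>] \<theta>_nonneg by (simp add: norm_Pair)
    also have "\<dots> \<le> m x + norm (x - y)" using that by (simp add: dist_norm)
    also have "\<dots> \<le> m y + A * norm (x - y)" using m_lip[of x y] by (simp add: A_def algebra_simps)
    also have "\<dots> \<le> ?\<phi> y" using A_pos norm_snd_le[of "x - y" "\<theta> x"] by simp
    finally show ?thesis .
  qed
  then show ?thesis using y0 by blast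
qed

private definition argm :: "'a \<Rightarrow> 'a" where
  "argm x = (SOME y0. \<forall>y. m y0 + A * norm (\<theta> x, x - y0) \<le> m y + A * norm (\<theta> x, x - y))"

text \<open>An infimal convolution of \<open>m\<close> with a multiple of the norm, whose tip is
  rounded by the extra coordinate \<open>\<theta> x\<close> wherever \<open>x\<close> lies off
  \<open>K\<close>.\<close>

private definition g :: "'a \<Rightarrow> real" where
  "g x = m (argm x) + A * norm (\<theta> x, x - argm x)"

private lemma g_le: "g x \<le> m y + A * norm (\<theta> x, x - y)"
  unfolding g_def argm_def using someI_ex[OF minimizer_exists[of x]] by blast

private lemma g_le_m: "g x \<le> m x + A * \<theta> x"
  using g_le[of x x] \<theta>_nonneg by (simp add: norm_Pair)

private lemma m_le_g: "m x \<le> g x"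
proof -
  have "m x \<le> m (argm x) + A * norm (x - argm x)"
    using m_lip[of x "argm x"] norm_ge_zero[of "x - argm x"] unfolding A_def distrib_right by linarith
  also have "\<dots> \<le> g x"
    unfolding g_def using A_pos norm_snd_le[of "x - argm x" "\<theta> x"] by simp
  finally show ?thesis .
qed

text \<open>For each fixed \<open>y\<close> the minimized expression is \<open>A\<close>-Lipschitz
  in the pair \<open>(\<theta> x, x)\<close>, hence so is the minimum, and the pair depends
  continuously on \<open>x\<close>.\<close>

private lemma g_continuous: "continuous_on UNIV g"
proof -
  let ?h = "\<lambda>x. (\<theta> x, x)"
  have 1: "g x \<le> g y + A * norm (?h x - ?h y)" for x y
  proof -
    have "norm (\<theta> x, x - argm y) \<le> norm (\<theta> y, y - argm y) + norm (?h x - ?h y)"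
      using norm_triangle_ineq[of "(\<theta> y, y - argm y)" "?h x - ?h y"] by simp
    then have "A * norm (\<theta> x, x - argm y) \<le> A * norm (\<theta> y, y - argm y) + A * norm (?h x - ?h y)"
      using A_pos by (simp flip: distrib_left)
    then show ?thesis using g_le[of x "argm y"] by (simp add: g_def[of y])
  qed
  have h: "isCont ?h y" for y
    unfolding \<theta>_def by (intro continuous_intros)
  have "isCont g y" for y
    unfolding isCont_def
  proof (rule LIM_zero_cancel, rule Lim_null_comparison)
    show "eventually (\<lambda>x. norm (g x - g y) \<le> A * norm (?h x - ?h y)) (at y)"
    proof (intro always_eventually allI)
      fix x
      show "norm (g x - g y) \<le> A * norm (?h x - ?h y)"
        using 1[of x y] 1[of y x]
        unfolding real_norm_def norm_minus_commute[of "?h y" "?h x"] by linarith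
    qed
    show "((\<lambda>x. A * norm (?h x - ?h y)) \<longlongrightarrow> 0) (at y)"
      by (rule tendsto_mult_right_zero[OF tendsto_norm_zero[OF LIM_zero[OF h[unfolded isCont_def]]]])
  qed
  then show ?thesis by (simp add: continuous_at_imp_continuous_on)
qed

text \<open>On \<open>K\<close>, the bound \<open>g \<le> m + A * \<theta>\<close> and the
  differentiability of \<open>m\<close> give a touching function with a quadratic term. Off
  \<open>K\<close>, the minimizer is frozen and \<open>\<theta>\<close> is replaced by a
  differentiable \<open>T\<close> touching it from above; the norm stays differentiable because
  \<open>\<theta> x > 0\<close>.\<close>

private lemma g_touch: "\<exists>\<psi>. \<psi> differentiable (at x) \<and> \<psi> x = g x \<and> (\<forall>y. g y \<le> \<psi> y)"
proof (cases "x \<in> K")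
  case True
  have "\<theta> x = 0" using True by (simp add: \<theta>_def)
  let ?\<psi> = "\<lambda>y. m y + A * ((y - x) \<bullet> (y - x))"
  have "?\<psi> differentiable (at x)" using diff[OF True] by (intro derivative_intros) auto
  moreover have "?\<psi> x = g x" using m_le_g[of x] g_le_m[of x] \<open>\<theta> x = 0\<close> by simp
  moreover have "g y \<le> ?\<psi> y" for y
    using g_le_m[of y] mult_left_mono[OF \<theta>_le[OF True, of y], of A] A_pos by linarith
  ultimately show ?thesis by (intro exI[of _ ?\<psi>]) auto
next
  case False
  have pos: "0 < infdist x K" using False K infdist_pos_not_in_closed by blast
  obtain T :: "'a \<Rightarrow> real" where T: "T differentiable (at x)" "T x = \<theta> x" "\<And>y. \<theta> y \<le> T y"
  proof (cases "(infdist x K)\<^sup>2 \<le> 1")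
    case True
    obtain z where z: "z \<in> K" "infdist x K = dist x z" using infdist_attains_inf[OF K] by blast
    show thesis
    proof (rule that[of "\<lambda>y. (y - z) \<bullet> (y - z)"])
      show "(\<lambda>y. (y - z) \<bullet> (y - z)) differentiable (at x)"
        by (auto intro!: derivative_intros)
      show "(x - z) \<bullet> (x - z) = \<theta> x" using True z by (simp add: \<theta>_def dist_norm power2_norm_eq_inner)
    qed (use \<theta>_le[OF z(1)] in auto)
  next
    case False
    then show thesis by (intro that[of "\<lambda>_. 1"]) (auto simp: \<theta>_def)
  qed
  have "0 < \<theta> x" using pos by (simp add: \<theta>_def)
  let ?\<psi> = "\<lambda>y. m (argm x) + A * norm (T y, y - argm x)"
  have "(\<lambda>y. (T y, y - argm x)) differentiable (at x)"
  proof -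
    obtain D where "(T has_derivative D) (at x)" using T(1) by (auto simp: differentiable_def)
    then have "((\<lambda>y. (T y, y - argm x)) has_derivative (\<lambda>h. (D h, h - 0))) (at x)"
      by (intro has_derivative_Pair derivative_intros)
    then show ?thesis by (auto simp: differentiable_def)
  qed
  then have "norm \<circ> (\<lambda>y. (T y, y - argm x)) differentiable (at x)"
    using T(2) \<open>0 < \<theta> x\<close> by (intro differentiable_chain_at) (auto simp: zero_prod_def)
  then have "?\<psi> differentiable (at x)"
    by (intro differentiable_add differentiable_mult differentiable_const) (simp add: o_def)
  moreover have "?\<psi> x = g x" by (simp add: g_def T)
  moreover have "g y \<le> ?\<psi> y" for y
    using g_le[of y "argm x"] A_pos mult_left_mono[OF norm_Pair_mono[OF \<theta>_nonneg T(3)[of y], of "y - argm x"], of A]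
    by linarith
  ultimately show ?thesis by (intro exI[of _ ?\<psi>]) auto
qed

text \<open>The envelope of \<open>g\<close> is squeezed between \<open>m\<close> and
  \<open>m + A * \<theta>\<close>, which coincide on \<open>K\<close> and differ by at most
  \<open>L + 1\<close> elsewhere.\<close>

lemma differentiable_convex_above:
  obtains F where "convex_on UNIV F" "\<And>x. F differentiable (at x)"
    "\<And>x. m x \<le> F x" "\<And>x. F x \<le> m x + (L + 1)" "\<And>z. z \<in> K \<Longrightarrow> F z = m z"
proof
  have m_lower: "- C \<le> m x" for x
    using coercive[of x] mult_nonneg_nonneg[OF less_imp_le[OF \<eta>] norm_ge_zero[of x]] by linarith
  have lower: "- C \<le> g x" for x using m_le_g[of x] m_lower[of x] by linarith
  have bnd: "bounded {x. g x \<le> c}" for c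
  proof (rule bounded_subset)
    show "bounded (cball (0::'a) ((c + C) / \<eta>))" by simp
    have "norm x \<le> (c + C) / \<eta>" if "g x \<le> c" for x
      using coercive[of x] m_le_g[of x] that \<eta> by (simp add: pos_le_divide_eq mult.commute)
    then show "{x. g x \<le> c} \<subseteq> cball 0 ((c + C) / \<eta>)" by auto
  qed
  show "convex_on UNIV (convex_envelope g)" using lower by (rule convex_on_envelope)
  show "convex_envelope g differentiable (at x)" for x
    using lower g_continuous bnd g_touch by (rule envelope_differentiable)
  show ge: "m x \<le> convex_envelope g x" for x
    using lower convex_m m_le_g by (rule envelope_greatest)
  have le: "convex_envelope g x \<le> m x + A * \<theta> x" for x
    using envelope_le_fun[where g = g and c = "- C" and x = x, OF lower] g_le_m[of x] by linarith
  show "convex_envelope g x \<le> m x + (L + 1)" for x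
    using le[of x] mult_left_mono[OF \<theta>_le_1[of x] less_imp_le[OF A_pos]] A_def by linarith
  show "convex_envelope g z = m z" if "z \<in> K" for z
    using le[of z] ge[of z] that by (simp add: \<theta>_def)
qed

end

subsection \<open>Slopes, coercivity and the coercivity subspace\<close>

text \<open>For nonempty \<open>D\<close> this is the direction space of the affine hull of
  \<open>D\<close>.\<close>

definition difference_span :: "'a::euclidean_space set \<Rightarrow> 'a set" where
  "difference_span D = span {a - a' | a a'. a \<in> D \<and> a' \<in> D}"

lemma gradient_span_eq: "gradient_span E G = difference_span (G ` E)"
  unfolding gradient_span_def difference_span_def by (rule arg_cong[where f = span]) auto

lemma subspace_difference_span: "subspace (difference_span D)"
  by (simp add: difference_span_def)

lemma diff_in_difference_span: "a \<in> D \<Longrightarrow> a' \<in> D \<Longrightarrow> a - a' \<in> difference_span D"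
  unfolding difference_span_def by (blast intro: span_base)

lemma difference_span_mono: "D \<subseteq> D' \<Longrightarrow> difference_span D \<subseteq> difference_span D'"
  unfolding difference_span_def by (intro span_mono) blast

lemma difference_span_subset:
  assumes "subspace X" "\<And>a. a \<in> D \<Longrightarrow> a - a0 \<in> X"
  shows "difference_span D \<subseteq> X"
  unfolding difference_span_def
proof (rule span_minimal[OF _ assms(1)], safe)
  fix a a' assume "a \<in> D" "a' \<in> D"
  then have "(a - a0) - (a' - a0) \<in> X" using assms by (blast intro: subspace_diff)
  then show "a - a' \<in> X" by simp
qed

lemma convex_hull_diff_in_difference_span:
  assumes "b \<in> convex hull D" "a \<in> D"
  shows "b - a \<in> difference_span D"
proof -
  have "convex hull D \<subseteq> (+) a ` difference_span D"
  proof (rule hull_minimal)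
    show "D \<subseteq> (+) a ` difference_span D"
      using diff_in_difference_span[OF _ assms(2)] by (force simp: image_iff)
    show "convex ((+) a ` difference_span D)"
      by (simp add: convex_translation subspace_imp_convex subspace_difference_span)
  qed
  then show ?thesis using assms(1) by auto
qed

lemma norm_convex_hull_le:
  fixes D :: "'a::real_normed_vector set"
  assumes "b \<in> convex hull D" "\<And>a. a \<in> D \<Longrightarrow> norm a \<le> M"
  shows "norm b \<le> M"
proof -
  have "convex hull D \<subseteq> cball 0 M" using assms(2) by (intro hull_minimal) auto
  then show ?thesis using assms(1) by auto
qed

section \<open>Coercivity of families of affine functions\<close>

lemma difference_span_finite:
  assumes "D \<noteq> {}"
  obtains T where "finite T" "T \<noteq> {}" "T \<subseteq> D" "difference_span T = difference_span D"
proof -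
  obtain B where B: "B \<subseteq> {a - a' | a a'. a \<in> D \<and> a' \<in> D}" "independent B"
      "{a - a' | a a'. a \<in> D \<and> a' \<in> D} \<subseteq> span B"
    using maximal_independent_subset by blast
  have "\<forall>v\<in>B. \<exists>a a'. a \<in> D \<and> a' \<in> D \<and> v = a - a'" using B(1) by blast
  then obtain p q where pq: "\<And>v. v \<in> B \<Longrightarrow> p v \<in> D \<and> q v \<in> D \<and> v = p v - q v" by metis
  obtain a0 where "a0 \<in> D" using assms by blast
  \<comment> \<open>The endpoints of a basis of differences suffice; \<open>a0\<close> keeps
    \<open>T\<close> nonempty when the basis is empty.\<close>
  define T where "T = insert a0 (p ` B \<union> q ` B)"
  have "T \<subseteq> D" using pq \<open>a0 \<in> D\<close> by (auto simp: T_def)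
  have "v \<in> {a - a' | a a'. a \<in> T \<and> a' \<in> T}" if "v \<in> B" for v
    using pq[OF that] that unfolding T_def by blast
  then have "span B \<subseteq> difference_span T"
    unfolding difference_span_def by (intro span_mono) blast
  then have "{a - a' | a a'. a \<in> D \<and> a' \<in> D} \<subseteq> difference_span T"
    using B(3) by blast
  then have "difference_span D \<subseteq> difference_span T"
    unfolding difference_span_def[of D] by (rule span_minimal) (rule subspace_difference_span)
  moreover have "difference_span T \<subseteq> difference_span D"
    using \<open>T \<subseteq> D\<close> by (rule difference_span_mono)
  moreover have "finite T" using B(2) by (simp add: T_def finiteI_independent)
  moreover have "T \<noteq> {}" by (simp add: T_def)
  ultimately show thesis using that[of T] \<open>T \<subseteq> D\<close> by blast
qed

lemma normalized_orth_proj: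
  assumes "subspace Y" "orth_proj Y u \<noteq> 0"
  shows "orth_proj Y u /\<^sub>R norm (orth_proj Y u) \<in> {s \<in> Y. norm s = 1}"
  using assms orth_proj_mem(1)[OF assms(1)] by (simp add: subspace_scale)

text \<open>The deviations from the barycentre \<open>b\<close> sum to zero, so in each nonzero
  direction of their span some deviation has positive inner product. Compactness of the unit sphere
  makes this uniform.\<close>

lemma finite_average_coercive:
  assumes T: "finite T" "T \<noteq> {}"
  obtains b \<eta> where "b \<in> convex hull T" "0 < \<eta>"
    "\<And>u. \<exists>a\<in>T. \<eta> * norm (orth_proj (difference_span T) u) \<le> (a - b) \<bullet> u"
proof -
  define Y where "Y = difference_span T"
  have Y: "subspace Y" by (simp add: Y_def subspace_difference_span)
  define n where "n = real (card T)"
  have n: "0 < n" using T by (simp add: n_def card_gt_0_iff)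
  define b where "b = (\<Sum>a\<in>T. (1 / n) *\<^sub>R a)"
  have b: "b \<in> convex hull T"
    unfolding b_def using T n by (intro convex_sum convex_convex_hull) (auto simp: n_def hull_inc)
  have sum0: "(\<Sum>a\<in>T. (a - b) \<bullet> u) = 0" for u
  proof -
    have "(\<Sum>a\<in>T. a - b) = 0"
      using n by (simp add: sum_subtractf b_def scaleR_sum_right[symmetric] sum_constant_scaleR n_def[symmetric])
    then show ?thesis by (metis inner_sum_left inner_zero_left)
  qed
  let ?\<psi> = "\<lambda>u. \<Sum>a\<in>T. max 0 ((a - b) \<bullet> u)"
  let ?S = "{s \<in> Y. norm s = 1}"
  \<comment> \<open>If all positive parts vanished, the deviations would have nonpositive inner
    products with \<open>u\<close> of sum zero, making \<open>u \<in> Y\<close> orthogonal to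
    \<open>Y\<close>.\<close>
  have psi_pos: "0 < ?\<psi> u" if u: "u \<in> ?S" for u
  proof (rule ccontr)
    assume "\<not> 0 < ?\<psi> u"
    moreover have "0 \<le> ?\<psi> u" by (intro sum_nonneg) auto
    ultimately have "?\<psi> u = 0" by linarith
    then have "\<forall>a\<in>T. max 0 ((a - b) \<bullet> u) = 0"
      using T by (subst (asm) sum_nonneg_eq_0_iff) auto
    then have "\<forall>a\<in>T. 0 \<le> - ((a - b) \<bullet> u)" by (auto simp: max_def split: if_splits)
    moreover have "(\<Sum>a\<in>T. - ((a - b) \<bullet> u)) = 0" using sum0[of u] by (simp only: sum_negf)
    ultimately have z: "(a - b) \<bullet> u = 0" if "a \<in> T" for a
      using sum_nonneg_eq_0_iff[of T "\<lambda>a. - ((a - b) \<bullet> u)"] T that by auto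
    have "Y \<subseteq> {w. w \<bullet> u = 0}"
      unfolding Y_def
    proof (rule difference_span_subset)
      show "subspace {w. w \<bullet> u = 0}" by (auto simp: subspace_def inner_add_left)
    qed (use z in blast)
    then have "u \<bullet> u = 0" using u by blast
    then show False using u by simp
  qed
  have "compact ?S"
  proof -
    have "?S = Y \<inter> sphere 0 1" by auto
    then show ?thesis using Y by (simp add: closed_subspace closed_Int_compact)
  qed
  have "\<exists>\<mu>>0. \<forall>s\<in>?S. \<mu> \<le> ?\<psi> s"
  proof (cases "?S = {}")
    \<comment> \<open>The unit sphere is empty when \<open>Y = {0}\<close>, and any positive
      constant serves.\<close>
    case True
    then have "\<forall>s\<in>?S. 1 \<le> ?\<psi> s" by blast
    then show ?thesis using zero_less_one by blast
  next
    case False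
    have "continuous_on ?S ?\<psi>" by (intro continuous_intros)
    then obtain s0 where "s0 \<in> ?S" "\<And>s. s \<in> ?S \<Longrightarrow> ?\<psi> s0 \<le> ?\<psi> s"
      using continuous_attains_inf[OF \<open>compact ?S\<close> False] by blast
    then show ?thesis using psi_pos by blast
  qed
  then obtain \<mu> where \<mu>: "0 < \<mu>" "\<And>s. s \<in> ?S \<Longrightarrow> \<mu> \<le> ?\<psi> s" by blast
  have "\<exists>a\<in>T. \<mu> / n * norm (orth_proj Y u) \<le> (a - b) \<bullet> u" for u
  proof -
    have proj: "(a - b) \<bullet> u = (a - b) \<bullet> orth_proj Y u" if "a \<in> T" for a
    proof -
      have "- (b - a) \<in> Y"
        using convex_hull_diff_in_difference_span[OF b that] Y unfolding Y_def by (rule subspace_neg[rotated])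
      then show ?thesis using inner_orth_proj[OF Y, of "a - b" u] by simp
    qed
    show ?thesis
    proof (cases "orth_proj Y u = 0")
      case True
      then show ?thesis using T proj by auto
    next
      case False
      define r where "r = norm (orth_proj Y u)"
      define s where "s = orth_proj Y u /\<^sub>R r"
      have r: "0 < r" using False by (simp add: r_def)
      have s: "s \<in> ?S" unfolding s_def r_def by (rule normalized_orth_proj[OF Y False])
      \<comment> \<open>One of the \<open>n\<close> positive parts is at least their
        average.\<close>
      have "\<exists>a\<in>T. \<mu> / n \<le> max 0 ((a - b) \<bullet> s)"
      proof (rule ccontr)
        assume "\<not> ?thesis"
        then have "?\<psi> s < (\<Sum>a\<in>T. \<mu> / n)" using T by (intro sum_strict_mono) auto
        also have "\<dots> = \<mu>" using n by (simp add: n_def)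
        finally show False using \<mu>(2)[OF s] by simp
      qed
      then obtain a where a: "a \<in> T" "\<mu> / n \<le> max 0 ((a - b) \<bullet> s)" by blast
      moreover have "0 < \<mu> / n" using \<mu> n by simp
      ultimately have "\<mu> / n \<le> (a - b) \<bullet> s" by (simp add: le_max_iff_disj)
      then have "\<mu> / n * r \<le> (a - b) \<bullet> s * r" using r by (intro mult_right_mono) auto
      also have "\<dots> = (a - b) \<bullet> orth_proj Y u" using r by (simp add: s_def)
      finally show ?thesis using a proj by (auto simp: r_def)
    qed
  qed
  then show thesis using that[of b "\<mu> / n"] b \<mu> n by (simp add: Y_def)
qed

text \<open>Finitely many slopes already have the full difference span, and the constant terms of
  finitely many members have a common lower bound \<open>- C\<close>.\<close>

lemma affine_family_coercive:
  fixes \<A> :: "('a::euclidean_space \<times> real) set"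
  assumes "\<A> \<noteq> {}"
  obtains b \<eta> C where "b \<in> convex hull (fst ` \<A>)" "0 < \<eta>"
    "\<And>x. \<exists>p\<in>\<A>. b \<bullet> x + \<eta> * norm (orth_proj (difference_span (fst ` \<A>)) x) - C \<le> fst p \<bullet> x + snd p"
proof -
  have "fst ` \<A> \<noteq> {}" using assms by simp
  then obtain T where T: "finite T" "T \<noteq> {}" "T \<subseteq> fst ` \<A>"
      "difference_span T = difference_span (fst ` \<A>)"
    using difference_span_finite by metis
  obtain b \<eta> where b: "b \<in> convex hull T" "0 < \<eta>"
    "\<And>u. \<exists>a\<in>T. \<eta> * norm (orth_proj (difference_span T) u) \<le> (a - b) \<bullet> u"
    using finite_average_coercive[OF T(1,2)] by blast
  have "\<forall>a\<in>T. \<exists>\<alpha>. (a, \<alpha>) \<in> \<A>" using T(3) by force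
  then obtain \<alpha> where \<alpha>: "\<And>a. a \<in> T \<Longrightarrow> (a, \<alpha> a) \<in> \<A>" by metis
  define C where "C = (\<Sum>a\<in>T. \<bar>\<alpha> a\<bar>)"
  have C: "- C \<le> \<alpha> a" if "a \<in> T" for a
    using member_le_sum[of a T "\<lambda>a. \<bar>\<alpha> a\<bar>"] T that unfolding C_def by force
  show thesis
  proof (rule that[of b \<eta> C])
    show "b \<in> convex hull (fst ` \<A>)" using b(1) hull_mono[OF T(3)] by blast
    fix x
    obtain a where a: "a \<in> T" "\<eta> * norm (orth_proj (difference_span T) x) \<le> (a - b) \<bullet> x"
      using b(3) by blast
    then show "\<exists>p\<in>\<A>. b \<bullet> x + \<eta> * norm (orth_proj (difference_span (fst ` \<A>)) x) - C \<le> fst p \<bullet> x + snd p"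
      using C[OF a(1)] \<alpha>[OF a(1)] T(4) by (intro bexI[of _ "(a, \<alpha> a)"]) (auto simp: inner_diff_left)
  qed (rule b(2))
qed

text \<open>Along a direction \<open>u\<close> orthogonal to one admissible subspace the function is affine, whereas
  essential coercivity on another admissible subspace \<open>X'\<close> forbids this unless \<open>u\<close> is orthogonal
  to \<open>X'\<close>.\<close>

lemma coercive_representation_orthogonal_comp:
  fixes X X' :: "'a::euclidean_space set"
  assumes X: "subspace X" "v \<in> X\<^sup>\<bottom>" "\<And>x. F x = c (orth_proj X x) + v \<bullet> x"
    and X': "subspace X'" "v' \<in> X'\<^sup>\<bottom>" "essentially_coercive_on X' c'"
      "\<And>x. F x = c' (orth_proj X' x) + v' \<bullet> x"
  shows "X\<^sup>\<bottom> \<subseteq> X'\<^sup>\<bottom>"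
proof
  fix u assume u: "u \<in> X\<^sup>\<bottom>"
  define w where "w = orth_proj X' u"
  have w: "w \<in> X'" by (simp add: w_def orth_proj_mem X')
  obtain l where l: "linear l" and coer: "\<And>x::nat \<Rightarrow> 'a. (\<And>k. x k \<in> X') \<Longrightarrow>
      filterlim (\<lambda>k. norm (x k)) at_top sequentially \<Longrightarrow>
      filterlim (\<lambda>k. c' (x k) - l (x k)) at_top sequentially"
    using X'(3) unfolding essentially_coercive_on_def by metis
  have "w = 0"
  proof (rule ccontr)
    assume "w \<noteq> 0"
    define s where "s = v \<bullet> u - v' \<bullet> u - l w"
    have c': "c' (t *\<^sub>R w) - l (t *\<^sub>R w) = F 0 + t * s" for t
    proof -
      have "orth_proj X (t *\<^sub>R u) = orth_proj X 0"
        by (simp add: orth_proj_orthogonal_comp X u subspace_orthogonal_comp subspace_scale subspace_0)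
      then have "F (t *\<^sub>R u) = F 0 + t * (v \<bullet> u)" using X(3)[of "t *\<^sub>R u"] X(3)[of 0] by simp
      moreover have "F (t *\<^sub>R u) = c' (t *\<^sub>R w) + t * (v' \<bullet> u)"
        using X'(4)[of "t *\<^sub>R u"] by (simp add: w_def linear_scale[OF orth_proj_linear[OF X'(1)]])
      ultimately show ?thesis by (simp add: s_def linear_scale[OF l] algebra_simps)
    qed
    have lim: "filterlim (\<lambda>k. F 0 + (\<sigma> * real k) * s) at_top sequentially" if "\<sigma> \<noteq> 0" for \<sigma>
    proof -
      have "filterlim (\<lambda>k. real k * (\<bar>\<sigma>\<bar> * norm w)) at_top sequentially"
        using that \<open>w \<noteq> 0\<close>
        by (intro filterlim_at_top_mult_tendsto_pos[OF tendsto_const _ filterlim_real_sequentially]) auto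
      then have "filterlim (\<lambda>k. norm ((\<sigma> * real k) *\<^sub>R w)) at_top sequentially"
        by (simp add: abs_mult mult_ac)
      from coer[OF _ this] show ?thesis using w X'(1) by (simp add: c' subspace_scale)
    qed
    \<comment> \<open>An affine function of one real variable cannot tend to infinity in both
      directions.\<close>
    have "eventually (\<lambda>k. F 0 + 1 \<le> F 0 + (1 * real k) * s) sequentially"
      by (rule iffD1[OF filterlim_at_top, rule_format]) (rule lim, simp)
    moreover have "eventually (\<lambda>k. F 0 + 1 \<le> F 0 + (- 1 * real k) * s) sequentially"
      by (rule iffD1[OF filterlim_at_top, rule_format]) (rule lim, simp)
    ultimately have "eventually (\<lambda>k::nat. False) sequentially"
      by eventually_elim simp
    then show False by simp
  qed
  then show "u \<in> X'\<^sup>\<bottom>" using orth_proj_mem(2)[OF X'(1), of u] by (simp add: w_def)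
qed

section \<open>Identification of the coercivity subspace\<close>

text \<open>Linear growth above a linear function makes \<open>c\<close> essentially coercive. Any
  other admissible subspace has the same orthogonal complement, which determines a subspace.\<close>

lemma coercivity_subspace_eqI:
  fixes X :: "'a::euclidean_space set"
  assumes X: "subspace X" "v \<in> X\<^sup>\<bottom>" "\<And>x. F x = c (orth_proj X x) + v \<bullet> x"
    and coer: "0 < \<eta>" "\<And>x. x \<in> X \<Longrightarrow> b \<bullet> x + \<eta> * norm x - C \<le> c x"
  shows "coercivity_subspace F = X"
  unfolding coercivity_subspace_def
proof (rule the_equality)
  have ec: "essentially_coercive_on X c"
    unfolding essentially_coercive_on_def
  proof (intro exI conjI allI impI)
    show "linear (\<lambda>x. b \<bullet> x)" by (simp add: bounded_linear.linear bounded_linear_inner_right)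
    fix x :: "nat \<Rightarrow> 'a"
    assume x: "\<forall>k. x k \<in> X" and lim: "filterlim (\<lambda>k. norm (x k)) at_top sequentially"
    have "filterlim (\<lambda>k. - C + norm (x k) * \<eta>) at_top sequentially"
      using coer(1) by (intro filterlim_tendsto_add_at_top[OF tendsto_const]
          filterlim_at_top_mult_tendsto_pos[OF tendsto_const _ lim])
    then show "filterlim (\<lambda>k. c (x k) - b \<bullet> x k) at_top sequentially"
      by (rule filterlim_at_top_mono) (use coer(2) x in \<open>auto intro!: always_eventually simp: algebra_simps\<close>)
  qed
  show *: "subspace X \<and> (\<exists>v c. v \<in> X\<^sup>\<bottom> \<and> essentially_coercive_on X c \<and>
      (\<forall>x. F x = c (orth_proj X x) + v \<bullet> x))"
    using X ec by blast
  fix X' assume "subspace X' \<and> (\<exists>v c. v \<in> X'\<^sup>\<bottom> \<and> essentially_coercive_on X' c \<and>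
      (\<forall>x. F x = c (orth_proj X' x) + v \<bullet> x))"
  then obtain v' c' where X': "subspace X'" "v' \<in> X'\<^sup>\<bottom>" "essentially_coercive_on X' c'"
      "\<And>x. F x = c' (orth_proj X' x) + v' \<bullet> x" by blast
  have "X\<^sup>\<bottom> = X'\<^sup>\<bottom>"
    using coercive_representation_orthogonal_comp[OF X X']
      coercive_representation_orthogonal_comp[OF X'(1,2,4) X(1,2) ec X(3)] by blast
  then show "X' = X" using orthogonal_comp_self X(1) X'(1) by metis
qed

text \<open>All gradients have the same component \<open>v\<close> orthogonal to \<open>X\<close>,
  so the tangent inequalities from \<open>x\<close> to its projection and back give matching
  bounds.\<close>

lemma convex_eq_orth_proj_plus_linear:
  assumes F: "convex_on UNIV F" and d: "\<And>x. F differentiable (at x)"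
    and X: "subspace X" "v \<in> X\<^sup>\<bottom>" "\<And>x. grad F x - v \<in> X"
  shows "F x = F (orth_proj X x) + v \<bullet> x"
proof -
  define u where "u = x - orth_proj X x"
  have u: "u \<in> X\<^sup>\<bottom>" by (simp add: u_def orth_proj_mem X)
  have g: "grad F y \<bullet> u = v \<bullet> u" for y
    using inner_orthogonal_comp(1)[OF X(3) u, of y] by (simp add: inner_diff_left)
  have "v \<bullet> u = v \<bullet> x"
    using inner_orthogonal_comp(2)[OF orth_proj_mem(1)[OF X(1)] X(2), of x] by (simp add: u_def inner_diff_right)
  moreover have "F (orth_proj X x) + grad F (orth_proj X x) \<bullet> u \<le> F x"
    using convex_tangent_le[OF F d, of "orth_proj X x" x] by (simp add: u_def)
  moreover have "F x + grad F x \<bullet> (- u) \<le> F (orth_proj X x)"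
    using convex_tangent_le[OF F d, of x "orth_proj X x"] by (simp add: u_def)
  ultimately show ?thesis by (simp add: g)
qed

text \<open>The tangents of \<open>F\<close> form an affine family below \<open>F\<close> whose
  slopes are the gradients, so its coercivity passes to \<open>F\<close>. The component of the
  gradients orthogonal to the span of their differences is constant and serves as
  \<open>v\<close>.\<close>

lemma coercivity_subspace_convex:
  fixes F :: "'a::euclidean_space \<Rightarrow> real"
  assumes F: "convex_on UNIV F" and d: "\<And>x. F differentiable (at x)"
  shows "coercivity_subspace F = difference_span (range (grad F))"
    and "\<exists>v \<in> (difference_span (range (grad F)))\<^sup>\<bottom>. (\<forall>x. grad F x - v \<in> difference_span (range (grad F))) \<and>
      (\<forall>x. F x = F (orth_proj (difference_span (range (grad F))) x) + v \<bullet> x)"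
proof -
  define X where "X = difference_span (range (grad F))"
  have X: "subspace X" by (simp add: X_def subspace_difference_span)
  define v where "v = grad F 0 - orth_proj X (grad F 0)"
  have v: "v \<in> X\<^sup>\<bottom>" by (simp add: v_def orth_proj_mem X)
  have gv: "grad F x - v \<in> X" for x
  proof -
    have "(grad F x - grad F 0) + orth_proj X (grad F 0) \<in> X"
      using diff_in_difference_span[of _ "range (grad F)"]
      by (intro subspace_add X orth_proj_mem) (auto simp: X_def)
    then show ?thesis by (simp add: v_def algebra_simps)
  qed
  have rep: "F x = F (orth_proj X x) + v \<bullet> x" for x
    by (rule convex_eq_orth_proj_plus_linear[OF F d X v gv])
  define \<A> where "\<A> = range (\<lambda>y. (grad F y, F y - grad F y \<bullet> y))"
  have "fst ` \<A> = range (grad F)" by (auto simp: \<A>_def image_iff)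
  moreover have "\<A> \<noteq> {}" by (simp add: \<A>_def)
  ultimately obtain b \<eta> C where "0 < \<eta>"
    and b: "\<And>x. \<exists>p\<in>\<A>. b \<bullet> x + \<eta> * norm (orth_proj X x) - C \<le> fst p \<bullet> x + snd p"
    using affine_family_coercive[of \<A>] unfolding X_def by metis
  show "coercivity_subspace F = difference_span (range (grad F))"
    unfolding X_def[symmetric]
  proof (rule coercivity_subspace_eqI[OF X v rep \<open>0 < \<eta>\<close>])
    fix x assume "x \<in> X"
    obtain y where "b \<bullet> x + \<eta> * norm (orth_proj X x) - C \<le> grad F y \<bullet> x + (F y - grad F y \<bullet> y)"
      using b[of x] by (auto simp: \<A>_def)
    also have "\<dots> \<le> F x" using convex_tangent_le[OF F d, of y x] by (simp add: inner_diff_right)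
    finally show "b \<bullet> x + \<eta> * norm x - C \<le> F x" using orth_proj_id[OF X \<open>x \<in> X\<close>] by simp
  qed
  show "\<exists>v \<in> (difference_span (range (grad F)))\<^sup>\<bottom>. (\<forall>x. grad F x - v \<in> difference_span (range (grad F))) \<and>
      (\<forall>x. F x = F (orth_proj (difference_span (range (grad F))) x) + v \<bullet> x)"
    unfolding X_def[symmetric] using v gv rep by blast
qed

subsection \<open>Suprema of affine functions\<close>

definition affine_sup :: "('a::euclidean_space \<times> real) set \<Rightarrow> 'a \<Rightarrow> real" where
  "affine_sup \<A> x = (SUP p\<in>\<A>. fst p \<bullet> x + snd p)"

locale affine_family =
  fixes \<A> :: "('a::euclidean_space \<times> real) set" and M :: real
  assumes nonempty: "\<A> \<noteq> {}"
    and slopes: "\<And>p. p \<in> \<A> \<Longrightarrow> norm (fst p) \<le> M"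
    and bounded_somewhere: "\<exists>z c. \<forall>p\<in>\<A>. fst p \<bullet> z + snd p \<le> c"
begin

lemma M_nonneg: "0 \<le> M"
  using nonempty slopes norm_ge_zero order_trans by blast

lemma slope_inner_le: "p \<in> \<A> \<Longrightarrow> fst p \<bullet> h \<le> M * norm h"
  using norm_cauchy_schwarz[of "fst p" h] mult_right_mono[OF slopes norm_ge_zero[of h]] by (rule order_trans)

text \<open>Bounded slopes carry a common upper bound from one point to all points.\<close>

lemma bdd: "bdd_above ((\<lambda>p. fst p \<bullet> x + snd p) ` \<A>)"
proof -
  obtain z c where zc: "\<And>p. p \<in> \<A> \<Longrightarrow> fst p \<bullet> z + snd p \<le> c" using bounded_somewhere by blast
  show ?thesis
  proof (rule bdd_aboveI2)
    fix p assume "p \<in> \<A>"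
    then show "fst p \<bullet> x + snd p \<le> c + M * norm (x - z)"
      using slope_inner_le[of p "x - z"] zc[of p] by (simp add: inner_diff_right)
  qed
qed

lemma upper: "p \<in> \<A> \<Longrightarrow> fst p \<bullet> x + snd p \<le> affine_sup \<A> x"
  unfolding affine_sup_def by (rule cSUP_upper[OF _ bdd])

lemma least: "(\<And>p. p \<in> \<A> \<Longrightarrow> fst p \<bullet> x + snd p \<le> t) \<Longrightarrow> affine_sup \<A> x \<le> t"
  unfolding affine_sup_def by (rule cSUP_least[OF nonempty])

lemma lipschitz: "M-lipschitz_on UNIV (affine_sup \<A>)"
proof (rule lipschitz_onI[OF _ M_nonneg])
  have *: "affine_sup \<A> x \<le> affine_sup \<A> y + M * norm (x - y)" for x y
  proof (rule least)
    fix p assume "p \<in> \<A>"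
    then show "fst p \<bullet> x + snd p \<le> affine_sup \<A> y + M * norm (x - y)"
      using slope_inner_le[of p "x - y"] upper[of p y] by (simp add: inner_diff_right)
  qed
  fix x y
  show "dist (affine_sup \<A> x) (affine_sup \<A> y) \<le> M * dist x y"
    using *[of x y] *[of y x] unfolding dist_norm real_norm_def norm_minus_commute[of y x] by linarith
qed

lemma convex: "convex_on UNIV (affine_sup \<A>)"
proof (rule convex_onI)
  fix t :: real and x y :: 'a
  assume t: "0 < t" "t < 1"
  show "affine_sup \<A> ((1 - t) *\<^sub>R x + t *\<^sub>R y) \<le> (1 - t) * affine_sup \<A> x + t * affine_sup \<A> y"
  proof (rule least)
    fix p assume p: "p \<in> \<A>"
    have "fst p \<bullet> ((1 - t) *\<^sub>R x + t *\<^sub>R y) + snd p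
        = (1 - t) * (fst p \<bullet> x + snd p) + t * (fst p \<bullet> y + snd p)"
      by (simp add: inner_add_right algebra_simps)
    also have "\<dots> \<le> (1 - t) * affine_sup \<A> x + t * affine_sup \<A> y"
      using t upper[OF p] by (intro add_mono mult_left_mono) auto
    finally show "fst p \<bullet> ((1 - t) *\<^sub>R x + t *\<^sub>R y) + snd p
        \<le> (1 - t) * affine_sup \<A> x + t * affine_sup \<A> y" .
  qed
qed simp

text \<open>The slopes of nearly maximal members at \<open>z\<close> form a Cauchy sequence, whose
  limit is the gradient. Close to \<open>z\<close>, the members that are not nearly maximal cannot
  catch up.\<close>

lemma differentiable_of_concentrated_slopes:
  assumes conc: "\<And>e. 0 < e \<Longrightarrow> \<exists>\<delta>>0. \<forall>p\<in>\<A>. \<forall>q\<in>\<A>. affine_sup \<A> z - \<delta> \<le> fst p \<bullet> z + snd p \<longrightarrow>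
      affine_sup \<A> z - \<delta> \<le> fst q \<bullet> z + snd q \<longrightarrow> norm (fst p - fst q) \<le> e"
  shows "affine_sup \<A> differentiable (at z)"
proof -
  let ?S = "affine_sup \<A>"
  have "\<exists>p\<in>\<A>. ?S z - inverse (real (Suc k)) < fst p \<bullet> z + snd p" for k
  proof (rule ccontr)
    assume "\<not> ?thesis"
    then have "?S z \<le> ?S z - inverse (real (Suc k))" by (intro least) (auto simp: not_less)
    then show False by simp
  qed
  then obtain p where p: "\<And>k. p k \<in> \<A>" "\<And>k. ?S z - inverse (real (Suc k)) < fst (p k) \<bullet> z + snd (p k)"
    by metis
  have near: "\<exists>N. \<forall>k\<ge>N. ?S z - \<delta> \<le> fst (p k) \<bullet> z + snd (p k)" if "0 < \<delta>" for \<delta>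
  proof -
    have "eventually (\<lambda>k. inverse (real (Suc k)) < \<delta>) sequentially"
      using LIMSEQ_inverse_real_of_nat that by (rule order_tendstoD)
    then show ?thesis unfolding eventually_sequentially using p(2) by (meson diff_left_mono less_imp_le order_trans)
  qed
  have "Cauchy (\<lambda>k. fst (p k))"
  proof (rule CauchyI)
    fix e :: real assume "0 < e"
    then obtain \<delta> where "0 < \<delta>" and \<delta>: "\<And>p q. p \<in> \<A> \<Longrightarrow> q \<in> \<A> \<Longrightarrow> ?S z - \<delta> \<le> fst p \<bullet> z + snd p \<Longrightarrow>
      ?S z - \<delta> \<le> fst q \<bullet> z + snd q \<Longrightarrow> norm (fst p - fst q) \<le> e / 2"
      using conc[of "e / 2"] by auto
    obtain N where N: "\<And>k. N \<le> k \<Longrightarrow> ?S z - \<delta> \<le> fst (p k) \<bullet> z + snd (p k)" using near[OF \<open>0 < \<delta>\<close>] by blast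
    have "norm (fst (p i) - fst (p j)) < e" if "N \<le> i" "N \<le> j" for i j
      using \<delta>[OF p(1) p(1) N N, OF that] \<open>0 < e\<close> by linarith
    then show "\<exists>N. \<forall>i\<ge>N. \<forall>j\<ge>N. norm (fst (p i) - fst (p j)) < e" by blast
  qed
  then obtain s where s: "(\<lambda>k. fst (p k)) \<longlonglongrightarrow> s" unfolding Cauchy_convergent_iff convergent_def by blast
  have "norm s \<le> M"
    using tendsto_norm[OF s] slopes[OF p(1)] by (intro LIMSEQ_le_const2) auto
  have "GDERIV ?S z :> s"
  proof (rule convex_gderivI[OF convex])
    fix e :: real assume "0 < e"
    then obtain \<delta> where "0 < \<delta>" and \<delta>: "\<And>p q. p \<in> \<A> \<Longrightarrow> q \<in> \<A> \<Longrightarrow> ?S z - \<delta> \<le> fst p \<bullet> z + snd p \<Longrightarrow>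
      ?S z - \<delta> \<le> fst q \<bullet> z + snd q \<Longrightarrow> norm (fst p - fst q) \<le> e"
      using conc[of e] by blast
    obtain N where N: "\<And>k. N \<le> k \<Longrightarrow> ?S z - \<delta> \<le> fst (p k) \<bullet> z + snd (p k)" using near[OF \<open>0 < \<delta>\<close>] by blast
    have close: "norm (fst q - s) \<le> e" if "q \<in> \<A>" "?S z - \<delta> \<le> fst q \<bullet> z + snd q" for q
    proof (rule LIMSEQ_le_const2)
      show "(\<lambda>k. norm (fst q - fst (p k))) \<longlonglongrightarrow> norm (fst q - s)" by (intro tendsto_intros s)
      show "\<exists>N. \<forall>k\<ge>N. norm (fst q - fst (p k)) \<le> e" using \<delta>[OF that(1) p(1) that(2) N] by blast
    qed
    \<comment> \<open>A member lying \<open>\<delta>\<close> below at \<open>z\<close> gains at most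
      \<open>M * norm h\<close>, while the candidate tangent loses at most as much, whence the
      factor 2; the \<open>+ 1\<close> covers \<open>M = 0\<close>.\<close>
    have "?S (z + h) \<le> ?S z + s \<bullet> h + e * norm h" if h: "norm h < \<delta> / (2 * M + 1)" for h
    proof (rule least)
      fix q assume q: "q \<in> \<A>"
      show "fst q \<bullet> (z + h) + snd q \<le> ?S z + s \<bullet> h + e * norm h"
      proof (cases "?S z - \<delta> \<le> fst q \<bullet> z + snd q")
        case True
        have "(fst q - s) \<bullet> h \<le> e * norm h"
          using norm_cauchy_schwarz[of "fst q - s" h] mult_right_mono[OF close[OF q True] norm_ge_zero[of h]]
          by (rule order_trans)
        then show ?thesis using upper[OF q, of z] by (simp add: inner_add_right inner_diff_left)
      next
        case False
        have "norm h * (2 * M + 1) < \<delta>" using h M_nonneg by (simp add: pos_less_divide_eq)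
        then have "2 * (M * norm h) + norm h < \<delta>" by (simp add: algebra_simps)
        moreover have "- (M * norm h) \<le> s \<bullet> h"
          using Cauchy_Schwarz_ineq2[of s h] mult_right_mono[OF \<open>norm s \<le> M\<close> norm_ge_zero[of h]] by linarith
        moreover have "0 \<le> e * norm h" using \<open>0 < e\<close> by simp
        ultimately show ?thesis
          using False slope_inner_le[OF q, of h] norm_ge_zero[of h] unfolding inner_add_right by linarith
      qed
    qed
    moreover have "0 < \<delta> / (2 * M + 1)" using \<open>0 < \<delta>\<close> M_nonneg by simp
    ultimately show "\<exists>r>0. \<forall>h. norm h < r \<longrightarrow> ?S (z + h) \<le> ?S z + s \<bullet> h + e * norm h" by blast
  qed
  then show ?thesis by (auto simp: gderiv_def differentiable_def)
qed

end

locale coercive_affine_family = affine_family \<A> M for \<A> :: "('a::euclidean_space \<times> real) set" and M +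
  fixes X :: "'a set" and v :: 'a
  assumes X: "subspace X" "v \<in> X\<^sup>\<bottom>"
    and slopes_in: "\<And>p. p \<in> \<A> \<Longrightarrow> fst p - v \<in> X"
    and slopes_span: "difference_span (fst ` \<A>) = X"
begin

lemma slope_split:
  assumes "s - v \<in> X"
  shows "s \<bullet> x = s \<bullet> orth_proj X x + v \<bullet> x"
  using inner_orth_proj[OF X(1) assms, of x] inner_orthogonal_comp(2)[OF orth_proj_mem(1)[OF X(1)] X(2), of x]
  by (simp add: inner_diff_left)

text \<open>All slopes share the component \<open>v\<close> orthogonal to \<open>X\<close>, so it
  can be taken out of the supremum.\<close>

lemma affine_sup_split: "affine_sup \<A> x = affine_sup \<A> (orth_proj X x) + v \<bullet> x"
proof (rule antisym)
  show "affine_sup \<A> x \<le> affine_sup \<A> (orth_proj X x) + v \<bullet> x"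
    using upper[of _ "orth_proj X x"] slope_split[OF slopes_in, of _ x] by (intro least) fastforce
  have "affine_sup \<A> (orth_proj X x) \<le> affine_sup \<A> x - v \<bullet> x"
    using upper[of _ x] slope_split[OF slopes_in, of _ x] by (intro least) fastforce
  then show "affine_sup \<A> (orth_proj X x) + v \<bullet> x \<le> affine_sup \<A> x" by simp
qed

text \<open>The sup is only coercive along \<open>X\<close>, up to a linear function. Subtracting that function and
  adding the smooth convex function \<open>norm (1, x - orth_proj X x)\<close>, constant on \<open>X\<close>, makes it
  coercive on the whole space.\<close>

lemma smooth_extension:
  assumes E: "E \<noteq> {}"
    and diff: "\<And>z. z \<in> closure (orth_proj X ` E) \<Longrightarrow> affine_sup \<A> differentiable (at z)"
  obtains F where "convex_on UNIV F" "\<And>x. F differentiable (at x)" "M-lipschitz_on UNIV F"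
    "\<And>x. affine_sup \<A> x \<le> F x" "\<And>x. x \<in> E \<Longrightarrow> F x = affine_sup \<A> x"
    "coercivity_subspace F = X"
proof -
  let ?S = "affine_sup \<A>" and ?P = "orth_proj X" and ?K = "closure (orth_proj X ` E)"
  have P: "bounded_linear ?P" using orth_proj_linear[OF X(1)] by (simp add: linear_conv_bounded_linear)
  have Plin: "linear ?P" by (rule orth_proj_linear[OF X(1)])
  have PP: "?P (?P x) = ?P x" for x by (intro orth_proj_id orth_proj_mem X)
  obtain b \<eta> C where b: "b \<in> convex hull (fst ` \<A>)" "0 < \<eta>"
    "\<And>x. \<exists>p\<in>\<A>. b \<bullet> x + \<eta> * norm (?P x) - C \<le> fst p \<bullet> x + snd p"
    using affine_family_coercive[OF nonempty] unfolding slopes_span by metis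
  have S_coer: "b \<bullet> x + \<eta> * norm (?P x) - C \<le> ?S x" for x
    using b(3)[of x] upper[of _ x] order_trans by blast
  define Q where "Q x = norm (1::real, x - ?P x)" for x
  define m where "m x = ?S (?P x) - b \<bullet> ?P x + Q x" for x
  have mP: "m (?P x) = ?S (?P x) - b \<bullet> ?P x + 1" for x by (simp add: m_def Q_def PP norm_Pair)
  have KX: "?K \<subseteq> X"
    using orth_proj_mem(1)[OF X(1)] X(1) by (intro closure_minimal closed_subspace) auto
  have Q_lin: "1-lipschitz_on UNIV Q"
  proof (rule lipschitz_onI)
    fix x y
    have "\<bar>Q x - Q y\<bar> \<le> norm ((1::real, x - ?P x) - (1, y - ?P y))"
      unfolding Q_def by (rule norm_triangle_ineq3)
    also have "\<dots> = norm ((x - y) - ?P (x - y))"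
      by (simp add: norm_Pair linear_diff[OF Plin] algebra_simps)
    also have "\<dots> \<le> norm (x - y)"
    proof -
      have "((x - y) - ?P (x - y)) \<bullet> ?P (x - y) = 0"
        by (rule inner_orthogonal_comp(2)[OF orth_proj_mem[OF X(1)]])
      then have "(norm (x - y))\<^sup>2 = (norm ((x - y) - ?P (x - y)))\<^sup>2 + (norm (?P (x - y)))\<^sup>2"
        unfolding power2_norm_eq_inner by (simp add: inner_diff_left inner_diff_right inner_commute)
      then have "(norm ((x - y) - ?P (x - y)))\<^sup>2 \<le> (norm (x - y))\<^sup>2"
        using zero_le_power2[of "norm (?P (x - y))"] by linarith
      then show ?thesis by (rule power2_le_imp_le) (rule norm_ge_zero)
    qed
    finally show "dist (Q x) (Q y) \<le> 1 * dist x y" by (simp add: dist_norm)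
  qed simp
  define L where "L = M * 1 + norm b * 1 + 1"
  have "1-lipschitz_on UNIV ?P"
    using norm_orth_proj_le[OF X(1)]
    by (intro lipschitz_onI) (auto simp: dist_norm linear_diff[OF Plin, symmetric])
  have lip: "L-lipschitz_on UNIV m"
  proof -
    have 1: "(M * 1)-lipschitz_on UNIV (\<lambda>x. ?S (?P x))"
      by (rule lipschitz_on_compose2[OF \<open>1-lipschitz_on UNIV ?P\<close>]) (rule lipschitz_on_subset[OF lipschitz], simp)
    have "(norm b)-lipschitz_on UNIV (\<lambda>x. b \<bullet> x)"
    proof (rule lipschitz_onI)
      fix x y
      show "dist (b \<bullet> x) (b \<bullet> y) \<le> norm b * dist x y"
        using Cauchy_Schwarz_ineq2[of b "x - y"] by (simp add: dist_norm inner_diff_right)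
    qed simp
    then have 2: "(norm b * 1)-lipschitz_on UNIV (\<lambda>x. b \<bullet> ?P x)"
      by (intro lipschitz_on_compose2[OF \<open>1-lipschitz_on UNIV ?P\<close>]) (auto intro: lipschitz_on_subset)
    show ?thesis unfolding m_def L_def by (intro lipschitz_on_add lipschitz_on_diff 1 2 Q_lin)
  qed
  have conv: "convex_on UNIV m"
  proof (rule convex_onI)
    fix t :: real and x y :: 'a
    assume t: "0 < t" "t < 1"
    let ?z = "(1 - t) *\<^sub>R x + t *\<^sub>R y"
    have Pz: "?P ?z = (1 - t) *\<^sub>R ?P x + t *\<^sub>R ?P y"
      by (simp add: linear_add[OF Plin] linear_scale[OF Plin])
    have "?S (?P ?z) \<le> (1 - t) * ?S (?P x) + t * ?S (?P y)"
      unfolding Pz using t by (intro convex_onD[OF convex]) auto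
    moreover have "b \<bullet> ?P ?z = (1 - t) * (b \<bullet> ?P x) + t * (b \<bullet> ?P y)"
      by (simp add: Pz inner_add_right)
    moreover have "Q ?z \<le> (1 - t) * Q x + t * Q y"
    proof -
      have "(1::real, ?z - ?P ?z) = (1 - t) *\<^sub>R (1, x - ?P x) + t *\<^sub>R (1, y - ?P y)"
        unfolding Pz by (simp add: algebra_simps)
      then have "Q ?z \<le> norm ((1 - t) *\<^sub>R (1::real, x - ?P x)) + norm (t *\<^sub>R (1::real, y - ?P y))"
        unfolding Q_def by (metis norm_triangle_ineq)
      then show ?thesis using t unfolding Q_def norm_scaleR by simp
    qed
    ultimately show "m ?z \<le> (1 - t) * m x + t * m y"
      unfolding m_def by (simp add: algebra_simps)
  qed simp
  \<comment> \<open>The supremum controls the component in \<open>X\<close> and \<open>Q\<close> the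
    orthogonal one.\<close>
  have m_coer: "min \<eta> 1 * norm x - C \<le> m x" for x
  proof -
    have "min \<eta> 1 * norm x \<le> min \<eta> 1 * (norm (?P x) + norm (x - ?P x))"
      using norm_triangle_ineq[of "?P x" "x - ?P x"] b(2) by (intro mult_left_mono) auto
    also have "\<dots> \<le> \<eta> * norm (?P x) + 1 * norm (x - ?P x)"
      unfolding distrib_left by (intro add_mono mult_right_mono) auto
    also have "\<dots> \<le> \<eta> * norm (?P x) + Q x" using norm_snd_le[of "x - ?P x" "1::real"] by (simp add: Q_def)
    also have "\<dots> \<le> m x + C" using S_coer[of "?P x"] by (simp add: m_def PP)
    finally show ?thesis by simp
  qed
  have m_diff: "m differentiable (at z)" if "z \<in> ?K" for z
  proof -
    have Pz: "?P z = z" using that KX orth_proj_id X by blast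
    have Pd: "?P differentiable (at z)" using P by (rule bounded_linear_imp_differentiable)
    have "?S \<circ> ?P differentiable (at z)"
      by (rule differentiable_chain_at[OF Pd]) (simp add: Pz diff that)
    moreover have "(\<lambda>x. b \<bullet> ?P x) differentiable (at z)"
      by (rule bounded_linear_imp_differentiable[OF bounded_linear_compose[OF bounded_linear_inner_right P]])
    \<comment> \<open>The constant coordinate 1 keeps the pair away from the origin, the only point
      where the norm is not differentiable.\<close>
    moreover have "norm \<circ> (\<lambda>x. (1::real, x - ?P x)) differentiable (at z)"
    proof (rule differentiable_chain_at)
      have "((\<lambda>x. (1::real, x - ?P x)) has_derivative (\<lambda>h. (0, h - ?P h))) (at z)"
        by (intro has_derivative_Pair derivative_intros bounded_linear_imp_has_derivative[OF P])
      then show "(\<lambda>x. (1::real, x - ?P x)) differentiable (at z)" by (auto simp: differentiable_def)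
    qed (simp add: zero_prod_def)
    ultimately show ?thesis unfolding m_def Q_def o_def by (intro differentiable_add differentiable_diff)
  qed
  obtain H where H: "convex_on UNIV H" "\<And>x. H differentiable (at x)" "\<And>x. m x \<le> H x"
    "\<And>x. H x \<le> m x + (L + 1)" "\<And>z. z \<in> ?K \<Longrightarrow> H z = m z"
    using differentiable_convex_above[OF conv lip _ m_coer closed_closure _ m_diff] b(2) E
    by (metis closure_eq_empty image_is_empty min_less_iff_conj zero_less_one)
  \<comment> \<open>On \<open>X\<close>, \<open>m\<close> is the supremum minus \<open>b\<close>
    plus 1. Composing \<open>H\<close> with the projection and undoing these two changes leaves only
    \<open>v\<close> to be restored.\<close>
  define F where "F x = H (?P x) + b \<bullet> ?P x - 1 + v \<bullet> x" for x
  have F_convex: "convex_on UNIV F"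
  proof (rule convex_onI)
    fix t :: real and x y :: 'a
    assume t: "0 < t" "t < 1"
    let ?z = "(1 - t) *\<^sub>R x + t *\<^sub>R y"
    have Pz: "?P ?z = (1 - t) *\<^sub>R ?P x + t *\<^sub>R ?P y"
      by (simp add: linear_add[OF Plin] linear_scale[OF Plin])
    have "H (?P ?z) \<le> (1 - t) * H (?P x) + t * H (?P y)"
      unfolding Pz using t by (intro convex_onD[OF H(1)]) auto
    moreover have "b \<bullet> ?P ?z = (1 - t) * (b \<bullet> ?P x) + t * (b \<bullet> ?P y)"
      by (simp add: Pz inner_add_right)
    moreover have "v \<bullet> ?z = (1 - t) * (v \<bullet> x) + t * (v \<bullet> y)" by (simp add: inner_add_right)
    ultimately show "F ?z \<le> (1 - t) * F x + t * F y"
      unfolding F_def by (simp add: algebra_simps)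
  qed simp
  have F_diff: "F differentiable (at x)" for x
  proof -
    have "H \<circ> ?P differentiable (at x)"
      using H(2) by (intro differentiable_chain_at bounded_linear_imp_differentiable[OF P])
    moreover have "(\<lambda>x. b \<bullet> ?P x) differentiable (at x)"
      by (rule bounded_linear_imp_differentiable[OF bounded_linear_compose[OF bounded_linear_inner_right P]])
    moreover have "(\<lambda>x. v \<bullet> x) differentiable (at x)"
      by (rule bounded_linear_imp_differentiable[OF bounded_linear_inner_right])
    ultimately show ?thesis unfolding F_def o_def
      by (intro differentiable_add differentiable_diff differentiable_const)
  qed
  have S_le_F: "?S x \<le> F x" for x
    using H(3)[of "?P x"] mP[of x] affine_sup_split[of x] by (simp add: F_def)
  have F_le: "F x \<le> ?S x + (L + 1)" for x
    using H(4)[of "?P x"] mP[of x] affine_sup_split[of x] by (simp add: F_def)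
  \<comment> \<open>The construction of \<open>H\<close> used the constant \<open>L\<close>, but
    \<open>F\<close> stays within bounded distance of the \<open>M\<close>-Lipschitz supremum, so
    its gradients obey the bound \<open>M\<close>.\<close>
  have "norm (grad F x) \<le> M" for x
  proof (rule norm_grad_le_growth[OF F_convex F_diff M_nonneg])
    fix y show "F y \<le> M * norm y + (?S 0 + (L + 1))"
      using F_le[of y] lipschitz_onD[OF lipschitz, of y 0] by (simp add: dist_norm)
  qed
  then have "M-lipschitz_on UNIV F" by (rule lipschitz_of_grad_le[OF F_diff])
  moreover have "F x = ?S x" if "x \<in> E" for x
  proof -
    have "?P x \<in> ?K" using that closure_subset[of "?P ` E"] by (meson imageI subsetD)
    from H(5)[OF this] show ?thesis using mP[of x] affine_sup_split[of x] unfolding F_def by linarith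
  qed
  moreover have "coercivity_subspace F = X"
  proof (rule coercivity_subspace_eqI[OF X, where c = "\<lambda>y. H y + b \<bullet> y - 1" and \<eta> = "min \<eta> 1" and b = b and C = "C + 1"])
    fix x
    show "b \<bullet> x + min \<eta> 1 * norm x - (C + 1) \<le> H x + b \<bullet> x - 1" using H(3)[of x] m_coer[of x] by simp
  qed (use b(2) in \<open>simp_all add: F_def\<close>)
  ultimately show thesis using that F_convex F_diff S_le_F by blast
qed

end

subsection \<open>Sufficiency of the conditions\<close>

text \<open>The tangent at \<open>y\<close> is stored as slope and value at the origin, the form in
  which \<open>affine_sup\<close> evaluates its members.\<close>

definition jet :: "('a::euclidean_space \<Rightarrow> real) \<Rightarrow> ('a \<Rightarrow> 'a) \<Rightarrow> 'a \<Rightarrow> 'a \<times> real" where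
  "jet f G y = (G y, f y - G y \<bullet> y)"

lemma fst_jet: "fst (jet f G y) = G y"
  and jet_eval: "fst (jet f G y) \<bullet> x + snd (jet f G y) = f y + G y \<bullet> (x - y)"
  by (simp_all add: jet_def inner_diff_right)

text \<open>Condition (iv) forces almost maximal jets at \<open>z\<close> to have almost equal slopes: with points
  \<open>x k\<close> of \<open>E\<close> whose projections tend to \<open>z\<close>, their slopes are both close to \<open>G (x k)\<close>.\<close>

lemma (in coercive_affine_family) differentiable_on_closure_proj:
  assumes iv: "condition_iv E X f G"
    and jets: "jet f G ` E \<subseteq> \<A>"
    and on_E: "\<And>x. x \<in> E \<Longrightarrow> affine_sup \<A> x = f x"
    and others: "\<And>p x. p \<in> \<A> \<Longrightarrow> p \<notin> jet f G ` E \<Longrightarrow> x \<in> E \<Longrightarrow> fst p \<bullet> x + snd p \<le> f x - 1"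
    and z: "z \<in> closure (orth_proj X ` E)"
  shows "affine_sup \<A> differentiable (at z)"
proof (rule differentiable_of_concentrated_slopes)
  let ?S = "affine_sup \<A>" and ?P = "orth_proj X"
  \<comment> \<open>Every other member lies at least 1 below the supremum on the projection of
    \<open>E\<close>, hence by continuity also at \<open>z\<close>; within 1/2 of the supremum only
    jets occur.\<close>
  have is_jet: "p \<in> jet f G ` E" if p: "p \<in> \<A>" "?S z - 1 / 2 \<le> fst p \<bullet> z + snd p" for p
  proof (rule ccontr)
    assume p': "p \<notin> jet f G ` E"
    have "closed {y. fst p \<bullet> y + snd p \<le> ?S y - 1}"
      using lipschitz_on_continuous_on[OF lipschitz]
      by (intro closed_Collect_le continuous_intros)
    moreover have "?P ` E \<subseteq> {y. fst p \<bullet> y + snd p \<le> ?S y - 1}"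
    proof safe
      fix x assume "x \<in> E"
      then show "fst p \<bullet> ?P x + snd p \<le> ?S (?P x) - 1"
        using others[OF p(1) p' \<open>x \<in> E\<close>] on_E[of x] affine_sup_split[of x]
          slope_split[OF slopes_in[OF p(1)], of x] by linarith
    qed
    ultimately have "z \<in> {y. fst p \<bullet> y + snd p \<le> ?S y - 1}" using z closure_minimal by blast
    then show False using p by simp
  qed
  obtain s where s: "\<And>k. s k \<in> ?P ` E" "s \<longlonglongrightarrow> z" using z unfolding closure_sequential by blast
  then have "\<forall>k. \<exists>x. x \<in> E \<and> s k = ?P x" by blast
  then obtain x where x: "\<And>k. x k \<in> E" "\<And>k. s k = ?P (x k)" by metis
  have slopes_close: "(\<lambda>k. norm (G (x k) - G (y k))) \<longlonglongrightarrow> 0"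
    if y: "\<And>k. y k \<in> E" "\<And>k. ?S z - inverse (real (Suc k)) \<le> f (y k) + G (y k) \<bullet> (z - y k)" for y
  proof (rule iv[unfolded condition_iv_def, rule_format, OF x(1) y(1)])
    show "bounded (range (\<lambda>k. ?P (x k)))"
      using convergent_imp_bounded[OF s(2)] by (simp add: x(2) image_def)
    show "(\<lambda>k. f (x k) - f (y k) - G (y k) \<bullet> (x k - y k)) \<longlonglongrightarrow> 0"
    proof (rule tendsto_sandwich[OF _ _ tendsto_const])
      have lo: "0 \<le> f (x k) - f (y k) - G (y k) \<bullet> (x k - y k)" for k
        using upper[of "jet f G (y k)" "x k"] jets y(1)[of k] on_E[OF x(1)] by (auto simp: jet_eval)
      then show "eventually (\<lambda>k. 0 \<le> f (x k) - f (y k) - G (y k) \<bullet> (x k - y k)) sequentially" by simp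
      \<comment> \<open>The left side is the gap at \<open>s k\<close> between the supremum and the
        jet of \<open>y k\<close>. Passing from \<open>z\<close> to \<open>s k\<close> changes each
        of the two by at most \<open>M * norm (s k - z)\<close>.\<close>
      have "f (x k) - f (y k) - G (y k) \<bullet> (x k - y k)
          \<le> inverse (real (Suc k)) + 2 * M * norm (s k - z)" for k
      proof -
        have p: "jet f G (y k) \<in> \<A>" using jets y(1) by blast
        have "f (x k) - f (y k) - G (y k) \<bullet> (x k - y k) = ?S (s k) - (f (y k) + G (y k) \<bullet> (s k - y k))"
          using on_E[OF x(1)[of k]] affine_sup_split[of "x k"] slope_split[OF slopes_in[OF p], of "x k"]
          unfolding x(2) inner_diff_right fst_jet by linarith
        moreover have "?S (s k) \<le> ?S z + M * norm (s k - z)"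
          using lipschitz_onD[OF lipschitz, of "s k" z] by (simp add: dist_norm)
        moreover have "G (y k) \<bullet> (z - s k) \<le> M * norm (s k - z)"
          using slope_inner_le[OF p, of "z - s k"] by (simp add: norm_minus_commute fst_jet)
        ultimately show ?thesis using y(2)[of k] by (simp add: inner_diff_right)
      qed
      then show "eventually (\<lambda>k. f (x k) - f (y k) - G (y k) \<bullet> (x k - y k)
          \<le> inverse (real (Suc k)) + 2 * M * norm (s k - z)) sequentially" by simp
      have "(\<lambda>k. inverse (real (Suc k)) + 2 * M * norm (s k - z)) \<longlonglongrightarrow> 0 + 2 * M * norm (z - z)"
        by (intro tendsto_intros s(2) LIMSEQ_inverse_real_of_nat)
      then show "(\<lambda>k. inverse (real (Suc k)) + 2 * M * norm (s k - z)) \<longlonglongrightarrow> 0" by simp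
    qed
  qed
  fix e :: real assume "0 < e"
  show "\<exists>\<delta>>0. \<forall>p\<in>\<A>. \<forall>q\<in>\<A>. ?S z - \<delta> \<le> fst p \<bullet> z + snd p \<longrightarrow>
      ?S z - \<delta> \<le> fst q \<bullet> z + snd q \<longrightarrow> norm (fst p - fst q) \<le> e"
  proof (rule ccontr)
    assume neg: "\<not> ?thesis"
    have "\<exists>y y'. y \<in> E \<and> y' \<in> E \<and> ?S z - inverse (real (Suc k)) \<le> f y + G y \<bullet> (z - y) \<and>
        ?S z - inverse (real (Suc k)) \<le> f y' + G y' \<bullet> (z - y') \<and> e < norm (G y - G y')" for k
    proof -
      \<comment> \<open>The cap 1/2 ensures that the offending members are jets.\<close>
      define \<delta> where "\<delta> = min (1 / 2) (inverse (real (Suc k)))"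
      have "0 < \<delta>" by (simp add: \<delta>_def)
      then obtain p q where pq: "p \<in> \<A>" "q \<in> \<A>" "?S z - \<delta> \<le> fst p \<bullet> z + snd p"
          "?S z - \<delta> \<le> fst q \<bullet> z + snd q" "e < norm (fst p - fst q)"
        using neg by (meson not_le)
      have "p \<in> jet f G ` E" "q \<in> jet f G ` E"
        using is_jet[OF pq(1)] is_jet[OF pq(2)] pq(3,4) unfolding \<delta>_def by linarith+
      then obtain y y' where y: "y \<in> E" "y' \<in> E" "p = jet f G y" "q = jet f G y'" by blast
      have "?S z - inverse (real (Suc k)) \<le> ?S z - \<delta>" by (simp add: \<delta>_def)
      then show ?thesis
        using y(1,2) order_trans[OF _ pq(3)] order_trans[OF _ pq(4)] pq(5)
        by (intro exI[of _ y] exI[of _ y']) (simp add: y(3,4) jet_eval, simp add: fst_jet)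
    qed
    then obtain y y' where y: "\<And>k. y k \<in> E" "\<And>k. y' k \<in> E"
        "\<And>k. ?S z - inverse (real (Suc k)) \<le> f (y k) + G (y k) \<bullet> (z - y k)"
        "\<And>k. ?S z - inverse (real (Suc k)) \<le> f (y' k) + G (y' k) \<bullet> (z - y' k)"
        "\<And>k. e < norm (G (y k) - G (y' k))"
      by metis
    have "(\<lambda>k. norm (G (x k) - G (y k)) + norm (G (x k) - G (y' k))) \<longlonglongrightarrow> 0"
      using tendsto_add[OF slopes_close[of y, OF y(1,3)] slopes_close[of y', OF y(2,4)]] by simp
    then have "eventually (\<lambda>k. norm (G (x k) - G (y k)) + norm (G (x k) - G (y' k)) < e) sequentially"
      using \<open>0 < e\<close> by (rule order_tendstoD)
    then have "eventually (\<lambda>k::nat. False) sequentially"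
    proof eventually_elim
      case (elim k)
      then show ?case
        using y(5)[of k] norm_triangle_ineq4[of "G (x k) - G (y' k)" "G (x k) - G (y k)"] by simp
    qed
    then show False by simp
  qed
qed

text \<open>The bound is exactly \<open>M\<close> when no slopes have to be added, which the case of
  vanishing \<open>G\<close> and \<open>X = {0}\<close> relies on; otherwise the added slopes have
  norm at most \<open>M + \<kappa>\<close>.\<close>

lemma extension_exists:
  fixes X :: "'a::euclidean_space set"
  assumes X: "subspace X" and cond: "extension_conditions E X f G" and E: "E \<noteq> {}"
    and M: "\<And>y. y \<in> E \<Longrightarrow> norm (G y) \<le> M" and \<kappa>: "0 < \<kappa>"
  obtains F where "convex_C1_extension E X f G F"
    "(if gradient_span E G = X then M else M + \<kappa>)-lipschitz_on UNIV F"
proof -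
  define Y where "Y = difference_span (G ` E)"
  have Y: "subspace Y" by (simp add: Y_def subspace_difference_span)
  have gs: "gradient_span E G = Y" by (simp add: Y_def gradient_span_eq)
  define J where "J = {1..dim X - dim Y}"
  have i: "\<And>x y. x \<in> E \<Longrightarrow> y \<in> E \<Longrightarrow> f y + G y \<bullet> (x - y) \<le> f x"
    and YX: "Y \<subseteq> X" and iii: "condition_iii E X G" and iv: "condition_iv E X f G"
    using cond unfolding extension_conditions_def condition_i_def condition_ii_def gs by auto
  have "\<exists>p \<epsilon> w. 0 < \<epsilon> \<and> \<epsilon> < 1 \<and> inj_on w J \<and> independent (w ` J) \<and>
      (\<forall>j\<in>J. w j \<in> X \<inter> Y\<^sup>\<bottom> \<and> norm (w j) = 1) \<and> (\<forall>j\<in>J. cone_at Y \<epsilon> (w j) (p j) \<inter> closure E = {})"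
  proof (cases "Y = X")
    case True
    \<comment> \<open>No cones are required here, so arbitrary values serve.\<close>
    then have "J = {}" by (simp add: J_def)
    then show ?thesis by (intro exI[of _ "\<lambda>_. 0"] exI[of _ "1/2"]) (auto simp: independent_empty)
  next
    case False
    then show ?thesis using iii unfolding condition_iii_def Let_def gs J_def[symmetric] by metis
  qed
  then obtain p \<epsilon> w where \<epsilon>: "0 < \<epsilon>" "\<epsilon> < 1" and w: "inj_on w J" "independent (w ` J)"
    "\<And>j. j \<in> J \<Longrightarrow> w j \<in> X \<and> w j \<in> Y\<^sup>\<bottom> \<and> norm (w j) = 1"
    and cone: "\<And>j. j \<in> J \<Longrightarrow> cone_at Y \<epsilon> (w j) (p j) \<inter> closure E = {}" by blast
  have outside: "\<epsilon> * (w j \<bullet> (x - p j)) \<le> norm (orth_proj Y (x - p j))" if "j \<in> J" "x \<in> E" for j x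
  proof -
    have "x \<notin> cone_at Y \<epsilon> (w j) (p j)" using cone[OF that(1)] that(2) closure_subset by blast
    then show ?thesis by (simp add: cone_at_def)
  qed

  have fst_jets: "fst ` jet f G ` E = G ` E" unfolding image_image fst_jet by (rule refl)
  obtain b \<eta>0 C where b: "b \<in> convex hull (G ` E)" "0 < \<eta>0"
    and lower: "\<And>x. \<exists>q\<in>jet f G ` E. b \<bullet> x + \<eta>0 * norm (orth_proj Y x) - C \<le> fst q \<bullet> x + snd q"
    using affine_family_coercive[of "jet f G ` E"] E unfolding fst_jets Y_def[symmetric] by blast
  \<comment> \<open>At most \<open>\<eta>0\<close>, so that the coercive lower bound of the jets
    still applies, and at most \<open>\<kappa>\<close>, so that added slopes exceed \<open>M\<close>
    by at most \<open>\<kappa>\<close>.\<close>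
  define \<eta> where "\<eta> = min \<eta>0 \<kappa>"
  have \<eta>: "0 < \<eta>" using b \<kappa> by (simp add: \<eta>_def)
  \<comment> \<open>Outside the cone, \<open>\<eta> * \<epsilon> * (w j \<bullet> (x - p j))\<close>
    is at most \<open>\<eta>\<close> times the norm of the projection of \<open>x - p j\<close> to
    \<open>Y\<close>. The lower bound of the jets absorbs this up to the subtracted constants, and
    the final 1 produces the gap.\<close>
  define extra where "extra j = (b + (\<eta> * \<epsilon>) *\<^sub>R w j,
      - (\<eta> * \<epsilon> * (w j \<bullet> p j)) - (C + \<eta> * norm (orth_proj Y (p j)) + 1))" for j
  define \<A> where "\<A> = jet f G ` E \<union> extra ` J"
  have extra_le: "fst (extra j) \<bullet> x + snd (extra j) \<le> f x - 1" if "j \<in> J" "x \<in> E" for j x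
  proof -
    have "fst (extra j) \<bullet> x + snd (extra j)
        = b \<bullet> x + \<eta> * (\<epsilon> * (w j \<bullet> (x - p j))) - (C + \<eta> * norm (orth_proj Y (p j)) + 1)"
      by (simp add: extra_def inner_add_left inner_diff_right algebra_simps)
    moreover have "\<eta> * (\<epsilon> * (w j \<bullet> (x - p j))) \<le> \<eta> * (norm (orth_proj Y x) + norm (orth_proj Y (p j)))"
    proof (intro mult_left_mono order_trans[OF outside[OF that]])
      show "norm (orth_proj Y (x - p j)) \<le> norm (orth_proj Y x) + norm (orth_proj Y (p j))"
        unfolding linear_diff[OF orth_proj_linear[OF Y]] by (rule norm_triangle_ineq4)
    qed (use \<eta> in simp)
    moreover have "\<eta> * norm (orth_proj Y x) \<le> \<eta>0 * norm (orth_proj Y x)"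
      by (intro mult_right_mono) (auto simp: \<eta>_def)
    moreover have "b \<bullet> x + \<eta>0 * norm (orth_proj Y x) - C \<le> f x"
    proof -
      obtain y where "y \<in> E" "b \<bullet> x + \<eta>0 * norm (orth_proj Y x) - C \<le> f y + G y \<bullet> (x - y)"
        using lower[of x] by (auto simp: jet_eval)
      then show ?thesis using i[OF that(2) \<open>y \<in> E\<close>] by linarith
    qed
    ultimately show ?thesis unfolding distrib_left by linarith
  qed
  obtain y0 where y0: "y0 \<in> E" using E by blast
  define v where "v = G y0 - orth_proj X (G y0)"
  have v: "v \<in> X\<^sup>\<bottom>" by (simp add: v_def orth_proj_mem X)
  have b_Y: "b - G y0 \<in> Y" unfolding Y_def using b(1) y0 by (intro convex_hull_diff_in_difference_span) auto
  have to_v: "a - v \<in> X" if "a - G y0 \<in> X" for a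
    using subspace_add[OF X that orth_proj_mem(1)[OF X, of "G y0"]] by (simp add: v_def algebra_simps)
  have slopes_X: "fst q - G y0 \<in> X" if q: "q \<in> \<A>" for q
    using q unfolding \<A>_def
  proof
    assume "q \<in> jet f G ` E"
    then show ?thesis using diff_in_difference_span[of _ "G ` E" "G y0"] y0 YX by (auto simp: Y_def fst_jet)
  next
    assume "q \<in> extra ` J"
    then obtain j where j: "j \<in> J" "q = extra j" by blast
    have "(b - G y0) + (\<eta> * \<epsilon>) *\<^sub>R w j \<in> X"
      using b_Y YX w(3)[OF j(1)] by (intro subspace_add subspace_scale X) auto
    then show ?thesis by (simp add: j extra_def algebra_simps)
  qed
  let ?B = "if gradient_span E G = X then M else M + \<kappa>"
  interpret affine_family \<A> ?B
  proof
    show "\<A> \<noteq> {}" using E by (simp add: \<A>_def)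
    show "\<exists>z c. \<forall>q\<in>\<A>. fst q \<bullet> z + snd q \<le> c"
    proof (intro exI ballI)
      fix q assume "q \<in> \<A>"
      then show "fst q \<bullet> y0 + snd q \<le> f y0"
        using i[OF y0] extra_le[OF _ y0] unfolding \<A>_def by (fastforce simp: jet_eval)
    qed
    fix q assume "q \<in> \<A>"
    then consider y where "y \<in> E" "q = jet f G y" | j where "j \<in> J" "q = extra j"
      unfolding \<A>_def by blast
    then show "norm (fst q) \<le> ?B"
    proof cases
      case 1
      then show ?thesis using M[of y] \<kappa> by (auto simp: fst_jet)
    next
      case 2
      then have "Y \<noteq> X" by (auto simp: J_def)
      have "norm b \<le> M" by (rule norm_convex_hull_le[OF b(1)]) (use M in auto)
      moreover have "norm ((\<eta> * \<epsilon>) *\<^sub>R w j) \<le> \<kappa>"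
      proof -
        have "\<eta> * \<epsilon> \<le> \<kappa> * 1" using \<epsilon> \<eta> \<kappa> by (intro mult_mono) (auto simp: \<eta>_def)
        then show ?thesis using w(3)[OF 2(1)] \<epsilon> \<eta> by simp
      qed
      ultimately have "norm (fst q) \<le> M + \<kappa>"
        using 2 norm_triangle_ineq[of b "(\<eta> * \<epsilon>) *\<^sub>R w j"] unfolding extra_def fst_conv by force
      then show ?thesis using \<open>Y \<noteq> X\<close> gs by simp
    qed
  qed
  define D where "D = difference_span (fst ` \<A>)"
  have D: "subspace D" by (simp add: D_def subspace_difference_span)
  have "D \<subseteq> X" unfolding D_def using slopes_X by (intro difference_span_subset[OF X]) auto
  have "G ` E \<subseteq> fst ` \<A>" unfolding \<A>_def image_Un image_image fst_jet by blast
  then have "Y \<subseteq> D" unfolding Y_def D_def by (rule difference_span_mono)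
  have wD: "w j \<in> D" if "j \<in> J" for j
  proof -
    have "fst (extra j) - G y0 \<in> D"
      using that y0 \<open>G ` E \<subseteq> fst ` \<A>\<close> unfolding D_def by (intro diff_in_difference_span) (auto simp: \<A>_def)
    then have "(fst (extra j) - G y0) - (b - G y0) \<in> D"
      by (rule subspace_diff[OF D]) (use b_Y \<open>Y \<subseteq> D\<close> in blast)
    then have "(\<eta> * \<epsilon>) *\<^sub>R w j \<in> D" by (simp add: extra_def)
    then have "inverse (\<eta> * \<epsilon>) *\<^sub>R ((\<eta> * \<epsilon>) *\<^sub>R w j) \<in> D"
      by (rule subspace_scale[OF D])
    moreover have "\<eta> * \<epsilon> \<noteq> 0" using \<eta> \<epsilon> by simp
    ultimately show ?thesis by (simp del: inverse_mult_distrib)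
  qed
  \<comment> \<open>\<open>D\<close> contains \<open>Y\<close> together with
    \<open>dim X - dim Y\<close> independent vectors orthogonal to \<open>Y\<close>, so the
    dimensions agree.\<close>
  have "D = X"
  proof (rule subspace_dim_equal[OF D X \<open>D \<subseteq> X\<close>])
    let ?Z = "{y \<in> D. \<forall>x\<in>Y. orthogonal x y}"
    have "w ` J \<subseteq> ?Z" using wD w(3) by (auto simp: orthogonal_comp_def)
    then have "card (w ` J) \<le> dim ?Z" using w(2) by (rule independent_card_le_dim)
    moreover have "card (w ` J) = dim X - dim Y" using w(1) by (simp add: card_image J_def)
    moreover have "dim ?Z + dim Y = dim D" by (rule dim_subspace_orthogonal_to_vectors[OF Y D \<open>Y \<subseteq> D\<close>])
    ultimately show "dim X \<le> dim D" by linarith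
  qed
  interpret coercive_affine_family \<A> ?B X v
    by unfold_locales (use X v to_v slopes_X \<open>D = X\<close> D_def in auto)
  have on_E: "affine_sup \<A> x = f x" if x: "x \<in> E" for x
  proof (rule antisym)
    show "affine_sup \<A> x \<le> f x"
    proof (rule least)
      fix q assume "q \<in> \<A>"
      then show "fst q \<bullet> x + snd q \<le> f x"
        using i[OF x] extra_le[OF _ x] unfolding \<A>_def by (fastforce simp: jet_eval)
    qed
    have "jet f G x \<in> \<A>" using x by (simp add: \<A>_def)
    from upper[OF this, of x] show "f x \<le> affine_sup \<A> x" by (simp add: jet_eval)
  qed
  have "affine_sup \<A> differentiable (at z)" if "z \<in> closure (orth_proj X ` E)" for z
    by (rule differentiable_on_closure_proj[OF iv _ on_E _ that]) (use extra_le in \<open>auto simp: \<A>_def\<close>)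
  then obtain F where F: "convex_on UNIV F" "\<And>x. F differentiable (at x)" "?B-lipschitz_on UNIV F"
    "\<And>x. affine_sup \<A> x \<le> F x" "\<And>x. x \<in> E \<Longrightarrow> F x = affine_sup \<A> x" "coercivity_subspace F = X"
    using smooth_extension[OF E] by metis
  \<comment> \<open>\<open>F\<close> lies above the jet of \<open>x\<close> and touches it at
    \<open>x\<close>, so \<open>G x\<close> is a subgradient there.\<close>
  have "grad F x = G x" if x: "x \<in> E" for x
  proof (rule grad_eq_subgradient[OF F(2)])
    fix y
    have "jet f G x \<in> \<A>" using x by (simp add: \<A>_def)
    then have "f x + G x \<bullet> (y - x) \<le> affine_sup \<A> y"
      using upper[of "jet f G x" y] by (simp add: jet_eval)
    then show "F x + G x \<bullet> (y - x) \<le> F y" using F(4)[of y] F(5)[OF x] on_E[OF x] by linarith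
  qed
  then have "convex_C1_extension E X f G F"
    unfolding convex_C1_extension_def C1_function_def
    using F on_E convex_lipschitz_grad_continuous[OF F(1-3)] by auto
  then show thesis using that F(3) by blast
qed

subsection \<open>Necessity of the conditions\<close>

lemma dim_orthogonal_comp_Int:
  fixes X Y :: "'a::euclidean_space set"
  assumes "subspace X" "subspace Y" "Y \<subseteq> X"
  shows "dim (X \<inter> Y\<^sup>\<bottom>) = dim X - dim Y"
proof -
  have "X \<inter> Y\<^sup>\<bottom> = {y \<in> X. \<forall>x\<in>Y. orthogonal x y}" by (auto simp: orthogonal_comp_def)
  then show ?thesis using dim_subspace_orthogonal_to_vectors[OF assms(2,1,3)] by simp
qed

text \<open>Monotonicity of the gradient bounds the component of \<open>x - p\<close> along \<open>u\<close> by that along \<open>Y\<close>;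
  equality would give \<open>x\<close> and \<open>p\<close> the same gradient.\<close>

lemma cone_avoids_gradient_level:
  fixes F :: "'a::euclidean_space \<Rightarrow> real"
  assumes F: "convex_on UNIV F" and d: "\<And>x. F differentiable (at x)"
    and L: "\<And>x. norm (grad F x) \<le> L" and Y: "subspace Y"
    and u_def: "u = (grad F p - g) - orth_proj Y (grad F p - g)" and u: "u \<noteq> 0"
    and \<mu>: "0 < \<mu>" "\<mu> \<le> norm u" and g: "norm g \<le> L"
    and x: "grad F x - g \<in> Y"
  shows "x \<notin> cone_at Y (\<mu> / (4 * L + 4)) (u /\<^sub>R norm u) p"
proof
  assume "x \<in> cone_at Y (\<mu> / (4 * L + 4)) (u /\<^sub>R norm u) p"
  then have cone: "norm (orth_proj Y (x - p)) \<le> \<mu> / (4 * L + 4) * ((u /\<^sub>R norm u) \<bullet> (x - p))"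
    by (simp add: cone_at_def)
  define r where "r = norm (orth_proj Y (x - p))"
  define s where "s = (u /\<^sub>R norm u) \<bullet> (x - p)"
  have us: "u \<bullet> (x - p) = norm u * s" using u by (simp add: s_def)
  have "0 \<le> r" by (simp add: r_def)
  have "0 \<le> L" using L norm_ge_zero order_trans by blast
  \<comment> \<open>The denominator makes \<open>4 * L * \<epsilon> < \<mu>\<close> strict and is
    positive also for \<open>L = 0\<close>.\<close>
  define \<epsilon> where "\<epsilon> = \<mu> / (4 * L + 4)"
  have \<epsilon>: "0 < \<epsilon>" "4 * L * \<epsilon> < \<mu>" using \<mu> \<open>0 \<le> L\<close> by (auto simp: \<epsilon>_def field_simps)
  have rs: "r \<le> \<epsilon> * s" using cone by (simp add: r_def s_def \<epsilon>_def)
  then have "0 \<le> s" using \<epsilon> \<open>0 \<le> r\<close> by (metis order_trans zero_le_mult_iff not_le order.strict_implies_order)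
  \<comment> \<open>The gradient difference splits as \<open>a - u\<close> with \<open>a\<close> in
    \<open>Y\<close> and \<open>u\<close> orthogonal to \<open>Y\<close>.\<close>
  define a where "a = (grad F x - g) - orth_proj Y (grad F p - g)"
  have aY: "a \<in> Y" unfolding a_def by (intro subspace_diff[OF Y] x orth_proj_mem[OF Y])
  have "norm a \<le> norm (grad F x - g) + norm (grad F p - g)"
    unfolding a_def using norm_triangle_ineq4 norm_orth_proj_le[OF Y] by (meson add_left_mono order_trans)
  also have "\<dots> \<le> 4 * L"
    using norm_triangle_ineq4[of "grad F x" g] norm_triangle_ineq4[of "grad F p" g] L[of x] L[of p] g by linarith
  finally have aL: "norm a \<le> 4 * L" .
  have split: "grad F x - grad F p = a - u" by (simp add: a_def u_def)
  have a_r: "a \<bullet> (x - p) \<le> 4 * L * r"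
  proof -
    have "a \<bullet> (x - p) = a \<bullet> orth_proj Y (x - p)" using inner_orth_proj[OF Y aY] by simp
    also have "\<dots> \<le> norm a * r" unfolding r_def by (rule norm_cauchy_schwarz)
    also have "\<dots> \<le> 4 * L * r" using aL \<open>0 \<le> r\<close> by (rule mult_right_mono)
    finally show ?thesis .
  qed
  have t1: "F p + grad F p \<bullet> (x - p) \<le> F x" and t2: "F x + grad F x \<bullet> (p - x) \<le> F p"
    by (rule convex_tangent_le[OF F d])+
  have "0 \<le> (grad F x - grad F p) \<bullet> (x - p)"
    using t1 t2 by (simp add: inner_diff_right inner_diff_left)
  then have "norm u * s \<le> 4 * L * r" using a_r unfolding split inner_diff_left us by linarith
  also have "\<dots> \<le> 4 * L * (\<epsilon> * s)" using rs \<open>0 \<le> L\<close> by (intro mult_left_mono) auto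
  finally have "norm u * s \<le> 4 * L * \<epsilon> * s" by simp
  moreover have "\<mu> * s \<le> norm u * s" using \<mu> \<open>0 \<le> s\<close> by (intro mult_right_mono)
  ultimately have "\<mu> * s \<le> 4 * L * \<epsilon> * s" by linarith
  then have "s = 0" using \<epsilon>(2) \<open>0 \<le> s\<close> by (simp add: mult_le_cancel_right)
  then have "r = 0" using rs \<open>0 \<le> r\<close> by simp
  then have "a \<bullet> (x - p) = 0" using inner_orth_proj[OF Y aY, of "x - p"] by (simp add: r_def)
  then have eq: "(grad F x - grad F p) \<bullet> (x - p) = 0" by (simp add: split inner_diff_left us \<open>s = 0\<close>)
  \<comment> \<open>The tangent at \<open>p\<close> meets \<open>F\<close> again at
    \<open>x\<close>, so its slope is also the gradient at \<open>x\<close>.\<close>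
  then have "F x = F p + grad F p \<bullet> (x - p)"
    using t1 t2 by (simp add: inner_diff_right inner_diff_left)
  then have "grad F x = grad F p"
    using convex_tangent_le[OF F d, of p] by (intro grad_eq_subgradient[OF d]) (simp add: inner_diff_right)
  then have "u = 0" using x orth_proj_id[OF Y] by (simp add: u_def)
  then show False using u by contradiction
qed

lemma condition_iii_necessary:
  fixes F :: "'a::euclidean_space \<Rightarrow> real"
  assumes F: "convex_on UNIV F" and d: "\<And>x. F differentiable (at x)" and lip: "L-lipschitz_on UNIV F"
    and G: "\<And>x. x \<in> E \<Longrightarrow> grad F x = G x"
  shows "condition_iii E (difference_span (range (grad F))) G"
proof -
  define X where "X = difference_span (range (grad F))"
  define Y where "Y = difference_span (G ` E)"
  have X: "subspace X" and Y: "subspace Y" by (simp_all add: X_def Y_def subspace_difference_span)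
  have gs: "gradient_span E G = Y" by (simp add: Y_def gradient_span_eq)
  have "G ` E \<subseteq> range (grad F)" using G by (auto simp: image_iff) metis
  then have YX: "Y \<subseteq> X" unfolding X_def Y_def by (rule difference_span_mono)
  have L: "norm (grad F x) \<le> L" for x by (rule norm_grad_le_lipschitz[OF F d lip])
  have "0 \<le> L" using lip by (rule lipschitz_on_nonneg)
  \<comment> \<open>For empty \<open>E\<close> the base point is arbitrary.\<close>
  obtain y0 where y0: "E = {} \<or> y0 \<in> E" by blast
  define g where "g = grad F y0"
  \<comment> \<open>Continuity of the gradient extends the inclusion from \<open>E\<close> to its
    closure, which the cones must avoid.\<close>
  have clE: "grad F x - g \<in> Y" if "x \<in> closure E" for x
  proof -
    have "closed {x. grad F x - g \<in> Y}"
    proof -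
      have "closed ((\<lambda>x. grad F x - g) -` Y)"
        using convex_lipschitz_grad_continuous[OF F d lip] Y
        by (intro closed_vimage closed_subspace continuous_intros)
      then show ?thesis by (simp add: vimage_def)
    qed
    moreover have "E \<subseteq> {x. grad F x - g \<in> Y}"
    proof
      fix x assume x: "x \<in> E"
      then have "y0 \<in> E" using y0 by blast
      then show "x \<in> {x. grad F x - g \<in> Y}"
        using x diff_in_difference_span[of "G x" "G ` E" "G y0"] by (simp add: Y_def g_def G)
    qed
    ultimately show ?thesis using that closure_minimal by blast
  qed
  define Q where "Q a = a - orth_proj Y a" for a
  have Qlin: "linear Q" unfolding Q_def
    using orth_proj_linear[OF Y] by (intro linear_compose_sub linear_id[unfolded id_def])
  define V where "V = X \<inter> Y\<^sup>\<bottom>"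
  have dimV: "dim V = dim X - dim Y" unfolding V_def by (rule dim_orthogonal_comp_Int[OF X Y YX])
  define S where "S = range (\<lambda>x. Q (grad F x - g))"
  have "S \<subseteq> V"
  proof -
    have "Q (grad F x - g) \<in> V" for x
    proof -
      have "grad F x - g \<in> X" unfolding X_def g_def by (intro diff_in_difference_span) auto
      then have "Q (grad F x - g) \<in> X" unfolding Q_def
        by (rule subspace_diff[OF X]) (use orth_proj_mem(1)[OF Y] YX in blast)
      then show ?thesis using orth_proj_mem(2)[OF Y] by (simp add: V_def Q_def)
    qed
    then show ?thesis by (auto simp: S_def)
  qed
  \<comment> \<open>\<open>Q\<close> maps the gradient differences, and hence all of
    \<open>X\<close>, into \<open>span S\<close>, and it fixes \<open>V\<close>.\<close>
  have "V \<subseteq> span S"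
  proof
    fix u assume u: "u \<in> V"
    have "X \<subseteq> {a. Q a \<in> span S}"
      unfolding X_def
    proof (rule difference_span_subset)
      show "subspace {a. Q a \<in> span S}"
        using linear_subspace_vimage[OF Qlin subspace_span, of S] by (simp add: vimage_def)
      show "a - g \<in> {a. Q a \<in> span S}" if "a \<in> range (grad F)" for a
        using that by (auto simp: S_def intro!: span_base)
    qed
    then have "Q u \<in> span S" using u by (auto simp: V_def)
    then show "u \<in> span S" using u orth_proj_orthogonal_comp[OF Y, of u] by (simp add: Q_def V_def)
  qed
  obtain B where B: "B \<subseteq> S" "independent B" "S \<subseteq> span B" using maximal_independent_subset by blast
  have finB: "finite B" using B(2) by (rule finiteI_independent)
  have "V \<subseteq> span B" using \<open>V \<subseteq> span S\<close> span_minimal[OF B(3) subspace_span] by blast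
  have BV: "B \<subseteq> V" using B(1) \<open>S \<subseteq> V\<close> by blast
  have cardB: "card B = dim V" by (rule basis_card_eq_dim[OF BV \<open>V \<subseteq> span B\<close> B(2)])
  define J where "J = {1..dim X - dim Y}"
  have cardJ: "card J = dim V" by (simp add: J_def dimV)
  obtain e where e: "bij_betw e J B"
    using ex_bij_betw_nat_finite_1[OF finB] unfolding cardB dimV J_def by blast
  have "\<forall>u\<in>B. \<exists>p. u = Q (grad F p - g)" using B(1) unfolding S_def by blast
  then obtain pt where pt: "\<And>u. u \<in> B \<Longrightarrow> u = Q (grad F (pt u) - g)" by metis
  have eB: "e j \<in> B" if "j \<in> J" for j using e that by (auto simp: bij_betw_def)
  have B0: "u \<noteq> 0" if "u \<in> B" for u using B(2) that dependent_zero by blast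
  define w where "w j = e j /\<^sub>R norm (e j)" for j
  define p where "p j = pt (e j)" for j
  have wV: "w j \<in> V" if "j \<in> J" for j
  proof -
    have "subspace V" unfolding V_def by (intro subspace_inter X subspace_orthogonal_comp)
    then show ?thesis unfolding w_def using eB[OF that] BV by (intro subspace_scale) auto
  qed
  have "V \<subseteq> span (w ` J)"
  proof -
    have "B \<subseteq> span (w ` J)"
    proof
      fix u assume u: "u \<in> B"
      then obtain j where j: "j \<in> J" "u = e j" using e by (auto simp: bij_betw_def)
      have "norm u *\<^sub>R w j \<in> span (w ` J)" using j by (intro span_scale span_base) auto
      then show "u \<in> span (w ` J)" using B0[OF u] j by (simp add: w_def)
    qed
    then show ?thesis using \<open>V \<subseteq> span B\<close> span_minimal[OF _ subspace_span] by blast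
  qed
  have finJ: "finite J" by (simp add: J_def)
  \<comment> \<open>A spanning family with as many indices as the dimension is both injective and
    independent.\<close>
  have "dim V \<le> card (w ` J)" using \<open>V \<subseteq> span (w ` J)\<close> finJ by (intro dim_le_card) auto
  then have cardw: "card (w ` J) = card J" using card_image_le[OF finJ, of w] cardJ by simp
  have inj: "inj_on w J" using finJ cardw by (rule eq_card_imp_inj_on)
  have ind: "independent (w ` J)"
    using card_eq_dim[of "w ` J" V] wV cardw cardJ finJ \<open>V \<subseteq> span (w ` J)\<close> by auto
  \<comment> \<open>Inserting 1 makes the minimum exist for empty \<open>B\<close> and forces the
    cone parameter below 1.\<close>
  define \<mu> where "\<mu> = Min (insert 1 (norm ` B))"
  have \<mu>: "0 < \<mu>" "\<mu> \<le> 1" using finB B0 by (auto simp: \<mu>_def)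
  have \<mu>_le: "\<mu> \<le> norm u" if "u \<in> B" for u using finB that by (auto simp: \<mu>_def)
  define \<epsilon> where "\<epsilon> = \<mu> / (4 * L + 4)"
  have "0 < \<epsilon>" "\<epsilon> < 1" using \<mu> \<open>0 \<le> L\<close> by (auto simp: \<epsilon>_def divide_less_eq)
  have cone: "x \<notin> cone_at Y \<epsilon> (w j) (p j)" if "j \<in> J" "x \<in> closure E" for j x
    unfolding \<epsilon>_def w_def
  proof (rule cone_avoids_gradient_level[OF F d L Y])
    show "e j = grad F (p j) - g - orth_proj Y (grad F (p j) - g)"
      using pt[OF eB[OF that(1)]] by (simp add: p_def Q_def)
    show "norm g \<le> L" by (simp add: g_def L)
  qed (use eB[OF that(1)] B0 \<mu> \<mu>_le clE[OF that(2)] in auto)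
  \<comment> \<open>The apex belongs to its own cone, so avoiding the cone already keeps
    \<open>p j\<close> out of the closure.\<close>
  have "p j \<in> cone_at Y \<epsilon> (w j) (p j)" for j
    using orth_proj_id[OF Y subspace_0[OF Y]] by (simp add: cone_at_def)
  then have "p j \<notin> closure E" if "j \<in> J" for j using cone[OF that] by blast
  moreover have "w j \<in> X \<inter> Y\<^sup>\<bottom> \<and> norm (w j) = 1" if "j \<in> J" for j
    using wV[OF that] B0[OF eB[OF that]] by (simp add: V_def w_def)
  ultimately show ?thesis
    unfolding condition_iii_def Let_def gs X_def[symmetric] J_def[symmetric]
    using \<open>0 < \<epsilon>\<close> \<open>\<epsilon> < 1\<close> inj ind cone
    by (intro impI exI[of _ p] exI[of _ \<epsilon>] exI[of _ w]) blast
qed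

text \<open>The quantity in (iv) is the error with which the gradient at \<open>z k\<close> is a
  subgradient at the projection of \<open>x k\<close>. Along a subsequence these projections
  converge, and the gradients at \<open>x k\<close> and at \<open>z k\<close> both tend to the
  gradient at the limit.\<close>

lemma condition_iv_necessary:
  fixes F :: "'a::euclidean_space \<Rightarrow> real"
  assumes F: "convex_on UNIV F" and d: "\<And>x. F differentiable (at x)" and lip: "L-lipschitz_on UNIV F"
    and fG: "\<And>x. x \<in> E \<Longrightarrow> F x = f x \<and> grad F x = G x"
  shows "condition_iv E (difference_span (range (grad F))) f G"
proof -
  define X where "X = difference_span (range (grad F))"
  have X: "subspace X" by (simp add: X_def subspace_difference_span)
  obtain v where v: "v \<in> X\<^sup>\<bottom>" "\<And>x. grad F x - v \<in> X" "\<And>x. F x = F (orth_proj X x) + v \<bullet> x"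
    using coercivity_subspace_convex(2)[OF F d] unfolding X_def by blast
  have sub: "F (orth_proj X x) + grad F a \<bullet> (y - orth_proj X x)
      - (F x - F a - grad F a \<bullet> (x - a)) \<le> F y" for x a y
  proof -
    have "(grad F a - v) \<bullet> (x - orth_proj X x) = 0" "v \<bullet> orth_proj X x = 0"
      using inner_orthogonal_comp(1)[OF v(2) orth_proj_mem(2)[OF X]]
        inner_orthogonal_comp(2)[OF orth_proj_mem(1)[OF X] v(1)] by auto
    then have "grad F a \<bullet> x - grad F a \<bullet> orth_proj X x = v \<bullet> x"
      by (simp add: inner_diff_left inner_diff_right)
    then show ?thesis using convex_tangent_le[OF F d, of a y] v(3)[of x]
      unfolding inner_diff_right by linarith
  qed
  have "(\<lambda>k. norm (G (x k) - G (z k))) \<longlonglongrightarrow> 0"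
    if x: "\<And>k. x k \<in> E" and z: "\<And>k. z k \<in> E" and bd: "bounded (range (\<lambda>k. orth_proj X (x k)))"
      and lim: "(\<lambda>k. f (x k) - f (z k) - G (z k) \<bullet> (x k - z k)) \<longlonglongrightarrow> 0" for x z :: "nat \<Rightarrow> 'a"
  proof (rule ccontr)
    assume "\<not> ?thesis"
    then obtain e where e: "0 < e"
      "\<not> eventually (\<lambda>k. norm (G (x k) - G (z k)) < e) sequentially"
      unfolding tendsto_iff dist_real_def by auto
    obtain r :: "nat \<Rightarrow> nat" where r: "strict_mono r" "\<And>k. \<not> norm (G (x (r k)) - G (z (r k))) < e"
      using not_eventually_sequentiallyD[OF e(2)] by auto
    have "bounded (range (\<lambda>k. orth_proj X (x (r k))))" by (rule bounded_subset[OF bd]) auto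
    then obtain l and r' :: "nat \<Rightarrow> nat" where r': "strict_mono r'" "((\<lambda>k. orth_proj X (x (r k))) \<circ> r') \<longlonglongrightarrow> l"
      using bounded_imp_convergent_subsequence by blast
    define \<rho> where "\<rho> = r \<circ> r'"
    have \<rho>: "strict_mono \<rho>" unfolding \<rho>_def by (rule strict_mono_o[OF r(1) r'(1)])
    have s: "(\<lambda>k. orth_proj X (x (\<rho> k))) \<longlonglongrightarrow> l" using r'(2) by (simp add: \<rho>_def o_def)
    have gz: "(\<lambda>k. grad F (z (\<rho> k))) \<longlonglongrightarrow> grad F l"
    proof (rule approx_subgradients_tendsto_grad[OF d lip s _ sub])
      show "(\<lambda>k. F (x (\<rho> k)) - F (z (\<rho> k)) - grad F (z (\<rho> k)) \<bullet> (x (\<rho> k) - z (\<rho> k))) \<longlonglongrightarrow> 0"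
        using LIMSEQ_subseq_LIMSEQ[OF lim \<rho>] fG[OF x] fG[OF z] by (simp add: o_def)
    qed
    \<comment> \<open>Here both points coincide and the error is 0.\<close>
    have gx: "(\<lambda>k. grad F (x (\<rho> k))) \<longlonglongrightarrow> grad F l"
      by (rule approx_subgradients_tendsto_grad[OF d lip s _ sub]) simp
    have "(\<lambda>k. norm (grad F (x (\<rho> k)) - grad F (z (\<rho> k)))) \<longlonglongrightarrow> norm (grad F l - grad F l)"
      by (intro tendsto_intros gx gz)
    then have "(\<lambda>k. norm (G (x (\<rho> k)) - G (z (\<rho> k)))) \<longlonglongrightarrow> 0" using fG[OF x] fG[OF z] by simp
    then have "eventually (\<lambda>k. norm (G (x (\<rho> k)) - G (z (\<rho> k))) < e) sequentially"
      using e(1) by (rule order_tendstoD)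
    then have "eventually (\<lambda>k::nat. False) sequentially"
      by eventually_elim (use r(2) in \<open>auto simp: \<rho>_def\<close>)
    then show False by simp
  qed
  then show ?thesis unfolding condition_iv_def X_def[symmetric] by blast
qed

lemma extension_conditions_necessary:
  assumes "convex_C1_extension E X f G F"
  shows "extension_conditions E X f G"
proof -
  have F: "convex_on UNIV F" and d: "\<And>x. F differentiable (at x)"
    and c: "continuous_on UNIV (grad F)" and fG: "\<And>x. x \<in> E \<Longrightarrow> F x = f x \<and> grad F x = G x"
    and XF: "coercivity_subspace F = X"
    using assms unfolding convex_C1_extension_def C1_function_def by auto
  obtain L where lip: "L-lipschitz_on UNIV F" using assms unfolding convex_C1_extension_def by blast
  have X: "X = difference_span (range (grad F))" using XF coercivity_subspace_convex(1)[OF F d] by simp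
  have "continuous_on E G"
    using continuous_on_subset[OF c subset_UNIV] by (rule continuous_on_eq) (simp add: fG)
  moreover have "bounded (G ` E)"
    unfolding bounded_iff
  proof (intro exI ballI)
    fix a assume "a \<in> G ` E"
    then obtain x where "a = grad F x" using fG by (metis imageE)
    then show "norm a \<le> L" using norm_grad_le_lipschitz[OF F d lip] by simp
  qed
  moreover have "f y + G y \<bullet> (x - y) \<le> f x" if "x \<in> E" "y \<in> E" for x y
    using convex_tangent_le[OF F d, of y x] fG that by simp
  ultimately have "condition_i E f G" by (simp add: condition_i_def)
  moreover have "condition_ii E X G"
  proof -
    have "G ` E \<subseteq> range (grad F)" using fG by (auto simp: image_iff) metis
    then show ?thesis unfolding condition_ii_def X gradient_span_eq by (rule difference_span_mono)
  qed
  moreover have "condition_iii E X G"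
    unfolding X by (rule condition_iii_necessary[OF F d lip]) (use fG in blast)
  moreover have "condition_iv E X f G"
    unfolding X by (rule condition_iv_necessary[OF F d lip]) (use fG in blast)
  ultimately show ?thesis by (simp add: extension_conditions_def)
qed

section \<open>The empty set and the final assembly\<close>

lemma convex_C1_extension_empty:
  "convex_C1_extension {0} X f G F \<Longrightarrow> convex_C1_extension {} X f' G' F"
  by (simp add: convex_C1_extension_def)

text \<open>Supplies data for an extension when \<open>E\<close> is empty. An orthonormal basis of
  \<open>X\<close> serves both as directions and as apices: the origin lies outside each cone
  because \<open>w j \<bullet> (0 - w j) = - 1\<close>.\<close>

lemma extension_conditions_point:
  fixes X :: "'a::euclidean_space set"
  assumes X: "subspace X"
  shows "extension_conditions {0} X (\<lambda>_. 0) (\<lambda>_. 0)"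
proof -
  obtain B where B: "B \<subseteq> X" "pairwise orthogonal B" "\<And>x. x \<in> B \<Longrightarrow> norm x = 1"
      "independent B" "card B = dim X" "span B = X"
    using orthonormal_basis_subspace[OF X] by blast
  have "finite B" using B(4) by (rule finiteI_independent)
  then obtain w where w: "bij_betw w {1..dim X} B"
    using ex_bij_betw_nat_finite_1 B(5) by metis
  have wB: "w j \<in> B" if "j \<in> {1..dim X}" for j using w that by (auto simp: bij_betw_def)
  have span0: "gradient_span {0::'a} (\<lambda>_. 0) = {0::'a}" by (simp add: gradient_span_def)
  have "0 \<notin> cone_at {0} (1 / 2) (w j) (w j)" "w j \<noteq> 0" "norm (w j) = 1" "w j \<in> X"
    if "j \<in> {1..dim X}" for j
  proof -
    show 1: "norm (w j) = 1" "w j \<in> X" using wB[OF that] B(1,3) by auto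
    then show "w j \<noteq> 0" by auto
    have "w j \<bullet> w j = 1" using 1 by (simp add: dot_square_norm)
    then have "1 / 2 * (w j \<bullet> (0 - w j)) < 0" by simp
    then show "0 \<notin> cone_at {0} (1 / 2) (w j) (w j)"
      using norm_ge_zero[of "orth_proj {0} (0 - w j)"] unfolding cone_at_def mem_Collect_eq by linarith
  qed note w_props = this
  have "condition_iii {0} X (\<lambda>_. 0::'a)"
    unfolding condition_iii_def Let_def span0
    by (intro impI exI[of _ w] exI[of _ "1 / 2"])
       (use w w_props B(4) in \<open>auto simp: bij_betw_def\<close>)
  then show ?thesis
    using X by (simp add: extension_conditions_def condition_i_def condition_ii_def condition_iv_def
        span0 subspace_0)
qed

theorem theorem1p14:
  shows "(\<forall>(E :: (real ^ 'n) set) X f G. subspace X \<longrightarrow>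
            ((\<exists>F. convex_C1_extension E X f G F) \<longleftrightarrow> extension_conditions E X f G)) \<and>
         (\<exists>C::real. C > 0 \<and>
            (\<forall>(E :: (real ^ 'n) set) X f G. subspace X \<longrightarrow> extension_conditions E X f G \<longrightarrow>
               ((\<forall>y\<in>E. G y = 0) \<longrightarrow> X = {0}) \<longrightarrow>
               (\<exists>F. convex_C1_extension E X f G F \<and>
                    Lip F = (SUP x. norm (grad F x)) \<and>
                    ennreal (Lip F) \<le> ennreal C * (SUP y\<in>E. ennreal (norm (G y))))))"
proof (intro conjI allI impI iffI)
  fix E :: "(real ^ 'n) set" and X f G
  assume "\<exists>F. convex_C1_extension E X f G F"
  then show "extension_conditions E X f G" using extension_conditions_necessary by blast
next
  fix E :: "(real ^ 'n) set" and X f G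
  assume X: "subspace X" and cond: "extension_conditions E X f G"
  show "\<exists>F. convex_C1_extension E X f G F"
  proof (cases "E = {}")
    case True
    then show ?thesis
      using extension_exists[OF X extension_conditions_point[OF X], of 0 1] convex_C1_extension_empty
      by (metis insert_not_empty norm_zero order_refl zero_less_one)
  next
    case False
    obtain M where "\<And>y. y \<in> E \<Longrightarrow> norm (G y) \<le> M"
      using cond unfolding extension_conditions_def condition_i_def bounded_iff by blast
    then show ?thesis using extension_exists[OF X cond False _ zero_less_one] by metis
  qed
next
  have Lip_bound: "Lip F = (SUP x. norm (grad F x)) \<and> Lip F \<le> L"
    if "convex_C1_extension E X f G F" "L-lipschitz_on UNIV F" for E X f G L and F :: "real ^ 'n \<Rightarrow> real"
  proof -
    have F: "convex_on UNIV F" "\<And>x. F differentiable (at x)"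
      using that(1) unfolding convex_C1_extension_def C1_function_def by auto
    have "Lip F = (SUP x. norm (grad F x))" by (rule Lip_eq_SUP_grad[OF F that(2)])
    moreover have "\<dots> \<le> L" by (rule cSUP_least) (use norm_grad_le_lipschitz[OF F that(2)] in auto)
    ultimately show ?thesis by simp
  qed
  show "\<exists>C::real. C > 0 \<and>
      (\<forall>(E :: (real ^ 'n) set) X f G. subspace X \<longrightarrow> extension_conditions E X f G \<longrightarrow>
         ((\<forall>y\<in>E. G y = 0) \<longrightarrow> X = {0}) \<longrightarrow>
         (\<exists>F. convex_C1_extension E X f G F \<and> Lip F = (SUP x. norm (grad F x)) \<and>
              ennreal (Lip F) \<le> ennreal C * (SUP y\<in>E. ennreal (norm (G y)))))"
  proof (intro exI[of _ 2] conjI allI impI)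
    fix E :: "(real ^ 'n) set" and X f G
    assume X: "subspace X" and cond: "extension_conditions E X f G"
      and X0: "(\<forall>y\<in>E. G y = 0) \<longrightarrow> X = {0}"
    obtain F :: "real ^ 'n \<Rightarrow> real" and L where F: "convex_C1_extension E X f G F" "L-lipschitz_on UNIV F"
      and L: "ennreal L \<le> ennreal 2 * (SUP y\<in>E. ennreal (norm (G y)))"
    proof (cases "\<forall>y\<in>E. G y = 0")
      \<comment> \<open>The right-hand side is 0, so \<open>F\<close> must be constant. As
        \<open>X = {0}\<close>, no slopes are added and the bound \<open>M = 0\<close> is
        kept.\<close>
      case True
      then have [simp]: "X = {0}" using X0 by simp
      show thesis
      proof (cases "E = {}")
        case True
        obtain F where F: "convex_C1_extension {0} X (\<lambda>_. 0) (\<lambda>_. 0) F"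
            "(if gradient_span {0} (\<lambda>_. 0) = X then 0 else 0 + 1)-lipschitz_on UNIV F"
          using extension_exists[OF X extension_conditions_point[OF X], of 0 1] by auto
        have "convex_C1_extension E X f G F"
          unfolding True by (rule convex_C1_extension_empty[OF F(1)])
        moreover have "0-lipschitz_on UNIV F" using F(2) by (simp add: gradient_span_def)
        ultimately show thesis by (rule that) simp
      next
        case False
        obtain F where "convex_C1_extension E X f G F"
            "(if gradient_span E G = X then 0 else 0 + 1)-lipschitz_on UNIV F"
          using extension_exists[OF X cond False, of 0 1] True by auto
        moreover have "gradient_span E G = X"
        proof -
          have "gradient_span E G \<subseteq> X"
            using cond by (simp add: extension_conditions_def condition_ii_def)
          moreover have "0 \<in> gradient_span E G" by (simp add: gradient_span_def span_0)
          ultimately show ?thesis by auto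
        qed
        ultimately show thesis using that[of F 0] by auto
      qed
    next
      case False
      then obtain y0 where y0: "y0 \<in> E" "G y0 \<noteq> 0" by blast
      have bdd: "bdd_above ((\<lambda>y. norm (G y)) ` E)"
        using cond unfolding extension_conditions_def condition_i_def bounded_iff bdd_above_def by auto
      define M where "M = (SUP y\<in>E. norm (G y))"
      have M: "norm (G y) \<le> M" if "y \<in> E" for y unfolding M_def by (rule cSUP_upper[OF that bdd])
      then have "0 < M" using y0 by (metis less_le_trans zero_less_norm_iff)
      \<comment> \<open>Since \<open>M > 0\<close>, the choice \<open>\<kappa> = M\<close> is
        allowed and gives the factor 2.\<close>
      obtain F where F: "convex_C1_extension E X f G F"
          "(if gradient_span E G = X then M else M + M)-lipschitz_on UNIV F"
        using extension_exists[OF X cond _ M \<open>0 < M\<close>] y0 by blast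
      have "(2 * M)-lipschitz_on UNIV F"
        by (rule lipschitz_on_mono[OF F(2)]) (use \<open>0 < M\<close> in auto)
      \<comment> \<open>The real supremum is compared with the extended one through nearly maximal
        points.\<close>
      moreover have "ennreal M \<le> (SUP y\<in>E. ennreal (norm (G y)))"
      proof (rule ennreal_le_epsilon)
        fix e :: real assume "0 < e"
        then have "M - e < (SUP y\<in>E. norm (G y))" by (simp add: M_def)
        then obtain y where y: "y \<in> E" "M - e < norm (G y)"
          using less_cSUP_iff[OF _ bdd] y0 by blast
        have "ennreal M \<le> ennreal (norm (G y) + e)" using y by (intro ennreal_leI) simp
        also have "\<dots> = ennreal (norm (G y)) + ennreal e" using \<open>0 < e\<close> by (intro ennreal_plus) auto
        also have "\<dots> \<le> (SUP y\<in>E. ennreal (norm (G y))) + ennreal e"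
          using y(1) by (intro add_right_mono SUP_upper)
        finally show "ennreal M \<le> (SUP y\<in>E. ennreal (norm (G y))) + ennreal e" .
      qed
      then have "ennreal (2 * M) \<le> ennreal 2 * (SUP y\<in>E. ennreal (norm (G y)))"
        using \<open>0 < M\<close> by (simp only: ennreal_mult' zero_le_numeral) (intro mult_left_mono, auto)
      ultimately show thesis using that F(1) by blast
    qed
    then show "\<exists>F. convex_C1_extension E X f G F \<and> Lip F = (SUP x. norm (grad F x)) \<and>
        ennreal (Lip F) \<le> ennreal 2 * (SUP y\<in>E. ennreal (norm (G y)))"
      using Lip_bound[OF F] order_trans[OF ennreal_leI L] by blast
  qed simp
qed

end
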